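(* Let $\alpha_1,\alpha_2>0$ and $\mu_j\in\mathcal M_{\alpha_j}(\mathbb R)$, $j=1,2$. Then $$C_{\alpha_1}[\mu_1](z)\,C_{\alpha_2}[\mu_2](z)=C_{\alpha_1+\alpha_2}[\mu](z),\qquad z\in\mathbb C^+,$$ with $\mu\in\mathcal M_{\alpha_1+\alpha_2}(\mathbb R)$ defined by $\mu(d\tau)=u(\tau)\,d\tau+\mu_1(\{\tau\})\mu_2(d\tau)$, where $$u(\tau)=\int_{\mathbb R}\int_{\mathbb R,\,s\neq t}G(\tau;s,t)\frac{\mu_1(ds)\,\mu_2(dt)}{(i+s)^{\alpha_1}(i+t)^{\alpha_2}},$$ and for $s,t\in\mathbb R$, $s\ne t$, $\tau\in\mathbb R$, $$G(\tau;s,t)=\frac{(i+\tau)^{\alpha_1+\alpha_2}}{\pi}\int_0^1\operatorname{Im}\Big(\frac{1}{\tau-\omega^{-1}\big(r\,\omega(s)+(1-r)\,\omega(t)\big)}\Big)\nu(dr),$$ with $\nu(dr)=B(\alpha_1,\alpha_2)^{-1}r^{\alpha_1-1}(1-r)^{\alpha_2-1}dr$, $\omega(z)=\frac{z-i}{z+i}$ and $\omega^{-1}(w)=i\frac{1+w}{1-w}$.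
   Context: $\mathbb C^+=\{z:\operatorname{Im}z>0\}$. For $\alpha\ge0$, $\mathcal M_\alpha(\mathbb R)$ is the space of complex Radon measures $\mu$ on $\mathbb R$ with $\int_{\mathbb R}(1+|t|)^{-\alpha}|\mu|(dt)<\infty$. For $\alpha>0$, $C_\alpha[\mu](z)=\int_{\mathbb R}\frac{\mu(dt)}{(z+t)^\alpha}$, $z\in\mathbb C^+$. All powers use the principal branch $z^\alpha=|z|^\alpha e^{i\alpha\arg z}$, $\arg z\in(-\pi,\pi)$. $B$ is the beta function. The Cayley transform $\omega$ maps $\overline{\mathbb C^+}$ homeomorphically onto the closed unit disc minus $\{1\}$. *)

theory Defs
  imports "HOL-Analysis.Analysis"
begin

text \<open>A complex Radon measure mu on the real line is represented by its polar
decomposition: a positive Borel measure M (= |mu|) together with a Borel function h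
with |h| = 1 everywhere, so that mu(dt) = h(t) M(dt).  Membership in M_alpha(R):\<close>

definition in_M :: "real \<Rightarrow> real measure \<Rightarrow> (real \<Rightarrow> complex) \<Rightarrow> bool" where
  "in_M \<alpha> M h \<longleftrightarrow> sets M = sets borel \<and> h \<in> borel_measurable borel \<and>
     (\<forall>t. norm (h t) = 1) \<and> integrable M (\<lambda>t. (1 + \<bar>t\<bar>) powr (- \<alpha>))"

definition gen_cauchy :: "real \<Rightarrow> real measure \<Rightarrow> (real \<Rightarrow> complex) \<Rightarrow> complex \<Rightarrow> complex" where
  "gen_cauchy \<alpha> M h z = (LINT t|M. h t / (z + complex_of_real t) powr complex_of_real \<alpha>)"

definition atom :: "real measure \<Rightarrow> (real \<Rightarrow> complex) \<Rightarrow> real \<Rightarrow> complex" where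
  "atom M h \<tau> = h \<tau> * complex_of_real (measure M {\<tau>})"

definition cayley :: "complex \<Rightarrow> complex" where
  "cayley z = (z - \<i>) / (z + \<i>)"

definition cayley_inv :: "complex \<Rightarrow> complex" where
  "cayley_inv w = \<i> * (1 + w) / (1 - w)"

definition kernG :: "real \<Rightarrow> real \<Rightarrow> real \<Rightarrow> real \<Rightarrow> real \<Rightarrow> complex" where
  "kernG \<alpha>\<^sub>1 \<alpha>\<^sub>2 \<tau> s t =
     (\<i> + complex_of_real \<tau>) powr complex_of_real (\<alpha>\<^sub>1 + \<alpha>\<^sub>2) / complex_of_real pi *
     complex_of_real (LINT r:{0<..<1}|lborel.
        Im (1 / (complex_of_real \<tau> - cayley_inv (complex_of_real r * cayley (complex_of_real s)
                 + complex_of_real (1 - r) * cayley (complex_of_real t))))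
        * (r powr (\<alpha>\<^sub>1 - 1) * (1 - r) powr (\<alpha>\<^sub>2 - 1) / (Beta \<alpha>\<^sub>1 \<alpha>\<^sub>2 :: real)))"

definition dens_u :: "real \<Rightarrow> real \<Rightarrow> real measure \<Rightarrow> (real \<Rightarrow> complex) \<Rightarrow>
    real measure \<Rightarrow> (real \<Rightarrow> complex) \<Rightarrow> real \<Rightarrow> complex" where
  "dens_u \<alpha>\<^sub>1 \<alpha>\<^sub>2 M1 h1 M2 h2 \<tau> =
     (LINT p|(M1 \<Otimes>\<^sub>M M2).
        (if fst p \<noteq> snd p then
           kernG \<alpha>\<^sub>1 \<alpha>\<^sub>2 \<tau> (fst p) (snd p) * h1 (fst p) * h2 (snd p)
           / ((\<i> + complex_of_real (fst p)) powr complex_of_real \<alpha>\<^sub>1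
              * (\<i> + complex_of_real (snd p)) powr complex_of_real \<alpha>\<^sub>2)
         else 0))"

end

theory Submission
  imports Defs "HOL-Complex_Analysis.Cauchy_Integral_Formula" "HOL-Real_Asymp.Real_Asymp"
begin

text \<open>
  Put $q_\alpha(w) = (1 + (z-\mathrm i)/(w+\mathrm i))^{-\alpha}$, so that
  $q_\alpha(s) = (\mathrm i+s)^\alpha/(z+s)^\alpha$ on the real line. Since
  $1/(w+\mathrm i)$ is an affine function of the Cayley transform of $w$, mixing Cayley transforms
  with weights $r, 1-r$ mixes the bases of these powers, and the Feynman parametrization gives
  $q_{\alpha_1}(s)\, q_{\alpha_2}(t) = \int_0^1 q_{\alpha_1+\alpha_2}(\zeta_r)\, \nu(dr)$ with
  $\zeta_r = \omega^{-1}(r\omega(s) + (1-r)\omega(t))$. For $s \neq t$ the point $\zeta_r$ lies in the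
  open half-plane, where the bounded holomorphic function $q_{\alpha_1+\alpha_2}$ is the Poisson integral of its boundary values.
  Integrating over $s \neq t$ with Fubini gives the density $u$; the diagonal $s = t$ only sees
  the atoms of $\mu_1$.
\<close>

subsection \<open>Integration over products\<close>

text \<open>Dividing by (i+s)^\<alpha> is what gives control of the integrals: it turns each given
  measure into a finite complex measure and the Cauchy kernel into a function bounded on the closed
  half-plane, so every exchange of integrals is dominated by a finite measure times a kernel of mass
  pi. The factor (i+\<tau>)^(\<open>\<alpha>\<^sub>1 + \<alpha>\<^sub>2\<close>) in G undoes this
  normalisation. The diagonal must be split off because for s = t the point \<zeta>_r = s is real.
  Its Poisson kernel would have to be a point mass at s, which no density represents, while the
  formula for G returns 0 there. The other obstacle is the principal branch, whose powers are not
  multiplicative, so every base has to be kept off the slit. The familiar proof of the Feynman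
  formula by Gamma integrals asks for bases with positive real part; the bases (z+s)/(i+s) can have
  negative real part, which is why they are deformed to 1 inside the slit plane instead.\<close>

lemma (in pair_sigma_finite) integrable_fst_times_snd:
  fixes f :: "'a \<Rightarrow> 'c :: {banach, second_countable_topology, real_normed_field}"
  assumes f: "integrable M1 f" and g: "integrable M2 g"
  shows "integrable (M1 \<Otimes>\<^sub>M M2) (\<lambda>p. f (fst p) * g (snd p))"
proof (rule Fubini_integrable)
  have [measurable]: "f \<in> borel_measurable M1" "g \<in> borel_measurable M2"
    using f g by auto
  show "(\<lambda>p. f (fst p) * g (snd p)) \<in> borel_measurable (M1 \<Otimes>\<^sub>M M2)"
    by measurable
qed (use f g in \<open>auto simp: norm_mult\<close>)

lemma (in pair_sigma_finite) integral_fst_times_snd: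
  fixes f :: "'a \<Rightarrow> 'c :: {banach, second_countable_topology, real_normed_field}"
  assumes f: "integrable M1 f" and g: "integrable M2 g"
  shows "(LINT p|(M1 \<Otimes>\<^sub>M M2). f (fst p) * g (snd p)) = (LINT x|M1. f x) * (LINT y|M2. g y)"
  using integral_fst'[OF integrable_fst_times_snd[OF f g]] by simp

text \<open>For fixed t the diagonal contains only the point s = t, so the inner integral over s
  sees a single atom, and Fubini does the rest. Integrability comes from domination by the full
  product.\<close>

lemma diagonal_times:
  fixes M1 M2 :: "real measure" and f g :: "real \<Rightarrow> complex"
  assumes "pair_sigma_finite M1 M2"
    and sets [measurable_cong]: "sets M1 = sets borel" "sets M2 = sets borel"
    and f: "integrable M1 f" and g: "integrable M2 g"
  shows integrable_diagonal_times:
      "integrable (M1 \<Otimes>\<^sub>M M2) (\<lambda>p. if fst p = snd p then f (fst p) * g (snd p) else 0)"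
    and integrable_atom_times: "integrable M2 (\<lambda>t. of_real (measure M1 {t}) * (f t * g t))"
    and integral_diagonal_times: "(LINT p|(M1 \<Otimes>\<^sub>M M2). (if fst p = snd p then f (fst p) * g (snd p) else 0))
           = (LINT t|M2. of_real (measure M1 {t}) * (f t * g t))"
proof -
  interpret pair_sigma_finite M1 M2 by fact
  have [measurable]: "f \<in> borel_measurable borel" "g \<in> borel_measurable borel"
    using borel_measurable_integrable[OF f] borel_measurable_integrable[OF g]
    unfolding measurable_cong_sets[OF sets(1) refl] measurable_cong_sets[OF sets(2) refl] .
  show int: "integrable (M1 \<Otimes>\<^sub>M M2) (\<lambda>p. if fst p = snd p then f (fst p) * g (snd p) else 0)"
    by (rule Bochner_Integration.integrable_bound[OF integrable_fst_times_snd[OF f g]]) auto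
  have "(LINT s|M1. (if s = t then f s * g t else 0)) = of_real (measure M1 {t}) * (f t * g t)" for t
  proof -
    have "(LINT s|M1. (if s = t then f s * g t else 0)) = (LINT s|M1. complex_of_real (indicator {t} s) * (f t * g t))"
      by (intro Bochner_Integration.integral_cong) (auto simp: indicator_def)
    also have "\<dots> = (LINT s|M1. complex_of_real (indicator {t} s)) * (f t * g t)"
      by (rule integral_mult_left_zero)
    also have "(LINT s|M1. complex_of_real (indicator {t} s)) = of_real (measure M1 {t})"
      using sets_eq_imp_space_eq[OF sets(1)] by simp
    finally show ?thesis .
  qed
  then show "integrable M2 (\<lambda>t. of_real (measure M1 {t}) * (f t * g t))"
    "(LINT p|(M1 \<Otimes>\<^sub>M M2). (if fst p = snd p then f (fst p) * g (snd p) else 0))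
           = (LINT t|M2. of_real (measure M1 {t}) * (f t * g t))"
    using integrable_snd[of "\<lambda>s t. if s = t then f s * g t else 0"]
      integral_snd[of "\<lambda>s t. if s = t then f s * g t else 0"] int
    by (simp_all add: case_prod_beta')
qed

subsection \<open>Poisson integrals in the upper half-plane\<close>

text \<open>An antiderivative is arctan((\<tau> - x)/y), whose limits at the two ends differ by pi.
  The kernel is left unnormalised, which matches the explicit 1/pi in \<open>kernG\<close>.\<close>

lemma poisson_kernel:
  assumes "Im \<zeta> > 0"
  shows integrable_poisson_kernel: "integrable lborel (\<lambda>\<tau>. Im (1 / (complex_of_real \<tau> - \<zeta>)))"
    and integral_poisson_kernel: "(LINT \<tau>|lborel. Im (1 / (complex_of_real \<tau> - \<zeta>))) = pi"
proof -
  define x y where "x = Re \<zeta>" and "y = Im \<zeta>"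
  have y: "y > 0" using assms by (simp add: y_def)
  let ?f = "\<lambda>\<tau>. y / ((\<tau> - x)\<^sup>2 + y\<^sup>2)"
  let ?F = "\<lambda>\<tau>. arctan ((\<tau> - x) / y)"
  have eq: "Im (1 / (complex_of_real \<tau> - \<zeta>)) = ?f \<tau>" for \<tau>
    by (simp add: Im_divide power2_eq_square x_def y_def)
  have pos: "(\<tau> - x)\<^sup>2 + y\<^sup>2 > 0" for \<tau> using y by (simp add: add_nonneg_pos)
  then have nz: "(\<tau> - x)\<^sup>2 + y\<^sup>2 \<noteq> 0" for \<tau> by (metis less_irrefl)
  have D: "(?F has_real_derivative ?f \<tau>) (at \<tau>)" for \<tau>
  proof -
    have "(?F has_real_derivative inverse (1 + ((\<tau> - x) / y)\<^sup>2) * (1 / y)) (at \<tau>)"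
      using y by (auto intro!: derivative_eq_intros)
    also have "inverse (1 + ((\<tau> - x) / y)\<^sup>2) * (1 / y) = ?f \<tau>"
      using y nz[of \<tau>] by (simp add: field_simps power2_eq_square)
    finally show ?thesis .
  qed
  have bot: "(?F \<longlongrightarrow> - (pi/2)) at_bot"
    by (rule filterlim_compose[OF tendsto_arctan_at_bot]) (use y in real_asymp)
  have top: "(?F \<longlongrightarrow> pi/2) at_top"
    by (rule filterlim_compose[OF tendsto_arctan_at_top]) (use y in real_asymp)
  note FTC = interval_integral_FTC_nonneg[of "-\<infinity>" \<infinity> ?F ?f "- (pi/2)" "pi/2"]
  have cont: "isCont ?f \<tau>" for \<tau>
    by (intro continuous_intros nz)
  have "set_integrable lborel (einterval (-\<infinity>) \<infinity>) ?f"
    by (rule FTC(1)) (use D cont bot top y in \<open>auto simp: ereal_tendsto_simps\<close>)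
  then show "integrable lborel (\<lambda>\<tau>. Im (1 / (complex_of_real \<tau> - \<zeta>)))"
    by (simp add: eq set_integrable_def)
  have "(LBINT x=-\<infinity>..\<infinity>. ?f x) = pi/2 - (- (pi/2))"
    by (rule FTC(2)) (use D cont bot top y in \<open>auto simp: ereal_tendsto_simps\<close>)
  then show "(LINT \<tau>|lborel. Im (1 / (complex_of_real \<tau> - \<zeta>))) = pi"
    by (simp add: eq interval_lebesgue_integral_def set_lebesgue_integral_def)
qed

text \<open>On the real line the Poisson kernel is Im \<zeta> / ((\<tau> - \<zeta>)(\<tau> - cnj
  \<zeta>)). Hence the claim says that (F w - F \<zeta>) / ((w - \<zeta>)(w - cnj \<zeta>)) has
  integral 0 over the line, which is Cauchy's theorem on large half-discs. Holomorphy slightly below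
  the axis puts the closed half-disc inside an open convex domain.\<close>

lemma poisson_half_plane:
  fixes F :: "complex \<Rightarrow> complex"
  assumes holo: "F holomorphic_on {w. Im w > - e}" and e: "e > 0"
    and bound: "\<And>w. Im w \<ge> 0 \<Longrightarrow> norm (F w) \<le> B" and \<zeta>: "Im \<zeta> > 0"
  shows "(LINT \<tau>|lborel. complex_of_real (Im (1 / (complex_of_real \<tau> - \<zeta>))) * F (complex_of_real \<tau>))
           = pi * F \<zeta>"
proof -
  \<comment> \<open>The bound d \<le> Im \<zeta> keeps the pole at cnj \<zeta> outside U, and d
    \<le> e keeps U inside the domain of F.\<close>
  define d where "d = min e (Im \<zeta>)"
  have d: "d > 0" "d \<le> e" "d \<le> Im \<zeta>" using e \<zeta> by (auto simp: d_def)
  define U where "U = {w. Im w > - d}"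
  have U: "open U" "convex U" unfolding U_def
    by (auto simp: open_halfspace_Im_gt convex_halfspace_Im_gt)
  have FU: "F holomorphic_on U"
    by (rule holomorphic_on_subset[OF holo]) (use d in \<open>auto simp: U_def\<close>)
  \<comment> \<open>Subtracting F \<zeta> makes the singularity at \<zeta> removable, with value
    \<open>deriv F \<zeta>\<close>, so no residue has to be computed.\<close>
  define H where "H = (\<lambda>w. (if w = \<zeta> then deriv F \<zeta> else (F w - F \<zeta>) / (w - \<zeta>)) / (w - cnj \<zeta>))"
  have H: "H holomorphic_on U" unfolding H_def
    by (intro holomorphic_on_divide pole_lemma_open FU U holomorphic_intros)
       (use d \<zeta> in \<open>auto simp: U_def complex_eq_iff\<close>)
  let ?P = "\<lambda>\<tau>. complex_of_real (Im (1 / (complex_of_real \<tau> - \<zeta>)))"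
  have B0: "B \<ge> 0" using order_trans[OF norm_ge_zero bound[of 0]] by simp
  have H_real: "H (of_real \<tau>) = ?P \<tau> * (F \<tau> - F \<zeta>) / Im \<zeta>" for \<tau> :: real
  proof -
    have ne: "complex_of_real \<tau> \<noteq> \<zeta>" "complex_of_real \<tau> \<noteq> cnj \<zeta>" using \<zeta> by (auto simp: complex_eq_iff)
    have Im_eq: "complex_of_real (Im w) = (w - cnj w) / (2 * \<i>)" for w
      by (subst complex_diff_cnj) (auto simp: complex_eq_iff)
    have "?P \<tau> = (1 / (\<tau> - \<zeta>) - cnj (1 / (\<tau> - \<zeta>))) / (2 * \<i>)"
      by (rule Im_eq)
    also have "\<dots> = (\<zeta> - cnj \<zeta>) / (2 * \<i>) / ((\<tau> - \<zeta>) * (\<tau> - cnj \<zeta>))"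
      using ne by (simp add: field_simps)
    also have "(\<zeta> - cnj \<zeta>) / (2 * \<i>) = Im \<zeta>" by (rule Im_eq[symmetric])
    finally have P: "?P \<tau> = Im \<zeta> / ((\<tau> - \<zeta>) * (\<tau> - cnj \<zeta>))" .
    show ?thesis unfolding P using ne \<zeta> by (simp add: H_def)
  qed
  have contF: "continuous_on UNIV (\<lambda>\<tau>::real. F (of_real \<tau>))"
    by (rule continuous_on_compose2[OF holomorphic_on_imp_continuous_on[OF FU]])
       (use d in \<open>auto simp: U_def intro!: continuous_intros\<close>)
  have intPF: "integrable lborel (\<lambda>\<tau>. ?P \<tau> * F \<tau>)"
  proof (rule Bochner_Integration.integrable_bound)
    show "integrable lborel (\<lambda>\<tau>. B * Im (1 / (complex_of_real \<tau> - \<zeta>)))"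
      by (intro integrable_mult_right integrable_poisson_kernel \<zeta>)
    show "(\<lambda>\<tau>. ?P \<tau> * F \<tau>) \<in> borel_measurable lborel"
      using borel_measurable_continuous_onI[OF contF] by measurable
    show "AE x in lborel. norm (?P x * F x) \<le> norm (B * Im (1 / (complex_of_real x - \<zeta>)))"
      using bound B0 by (auto simp: norm_mult abs_mult mult.commute[of B] intro!: mult_left_mono)
  qed
  have intP: "integrable lborel (\<lambda>\<tau>. ?P \<tau> * F \<zeta>)"
    by (intro integrable_mult_left integrable_of_real integrable_poisson_kernel \<zeta>)
  have intH: "integrable lborel (\<lambda>\<tau>. H (of_real \<tau>))"
    using Bochner_Integration.integrable_diff[OF intPF intP]
    unfolding H_real by (auto simp: right_diff_distrib)
  have contH: "continuous_on UNIV (\<lambda>\<tau>::real. H (of_real \<tau>))"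
    by (rule continuous_on_compose2[OF holomorphic_on_imp_continuous_on[OF H]])
       (use d in \<open>auto simp: U_def intro!: continuous_intros\<close>)
  define I where "I = (\<lambda>R. LINT \<tau>|lborel. indicator {-R..R} \<tau> *\<^sub>R H (of_real \<tau>))"
  \<comment> \<open>For R > 2 |\<zeta>| both \<zeta> and cnj \<zeta> are at distance at least R/2
    from the arc, so |H| is at most 2B / (R/2)^2 = 8B / R^2 on an arc of length pi R.\<close>
  have I_bound: "norm (I R) \<le> 8 * B * pi / R" if R: "R > 2 * norm \<zeta>" for R
  proof -
    have R0: "R > 0" using R norm_ge_zero[of \<zeta>] by linarith
    let ?arc = "part_circlepath 0 R 0 pi" and ?line = "linepath (- complex_of_real R) (of_real R)"
    have arc_im: "path_image ?arc \<subseteq> {w. Im w \<ge> 0 \<and> norm w = R}"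
      using R0 by (auto simp: path_image_part_circlepath' norm_mult closed_segment_eq_real_ivl
          intro!: mult_nonneg_nonneg sin_ge_zero)
    have line_im: "path_image ?line \<subseteq> U"
      using U(2) d by (simp add: closed_segment_subset U_def)
    have arcU: "path_image ?arc \<subseteq> U" using arc_im d by (auto simp: U_def)
    have ends: "pathstart ?arc = R" "pathfinish ?arc = -R"
      by (simp_all add: cis_conv_exp[symmetric])
    have "(H has_contour_integral 0) (?arc +++ ?line)"
      by (rule Cauchy_theorem_convex_simple[OF H U(2)])
         (use ends arcU line_im in \<open>auto simp: path_image_join\<close>)
    moreover have ia: "H contour_integrable_on ?arc"
      by (intro contour_integrable_continuous_part_circlepath
           holomorphic_on_imp_continuous_on holomorphic_on_subset[OF H] arcU)
    moreover have il: "H contour_integrable_on ?line"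
      by (intro contour_integrable_continuous_linepath holomorphic_on_imp_continuous_on
           holomorphic_on_subset[OF H] line_im[unfolded path_image_linepath])
    ultimately have "contour_integral ?arc H + contour_integral ?line H = 0"
      using contour_integral_join[of H ?arc ?line] ends contour_integral_unique by auto
    then have "norm (contour_integral ?line H) = norm (contour_integral ?arc H)"
      by (metis add_eq_0_iff norm_minus_cancel)
    also have "\<dots> \<le> (8 * B / R\<^sup>2) * R * \<bar>pi - 0\<bar>"
    proof (rule contour_integral_bound_part_circlepath[OF ia])
      fix w assume "w \<in> path_image ?arc"
      then have w: "Im w \<ge> 0" "norm w = R" using arc_im by auto
      have 1: "norm (w - \<zeta>) \<ge> R/2" using norm_triangle_ineq2[of w \<zeta>] w R by linarith
      have 2: "norm (w - cnj \<zeta>) \<ge> R/2" using norm_triangle_ineq2[of w "cnj \<zeta>"] w R by simp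
      have "w \<noteq> \<zeta>" using w R R0 by auto
      then have "norm (H w) = norm (F w - F \<zeta>) / (norm (w - \<zeta>) * norm (w - cnj \<zeta>))"
        by (simp add: H_def norm_divide norm_mult)
      also have "\<dots> \<le> (2*B) / ((R/2) * (R/2))"
      proof (intro frac_le mult_mono 1 2)
        show "norm (F w - F \<zeta>) \<le> 2 * B"
          using norm_triangle_ineq4[of "F w" "F \<zeta>"] bound[of w] bound[of \<zeta>] w \<zeta> by linarith
      qed (use R0 B0 in auto)
      also have "\<dots> = 8 * B / R\<^sup>2" by (simp add: power2_eq_square)
      finally show "norm (H w) \<le> 8 * B / R\<^sup>2" .
    qed (use R0 B0 in auto)
    also have "\<dots> = 8 * B * pi / R" using R0 by (simp add: power2_eq_square)
    also have "contour_integral ?line H = integral {-R..R} (\<lambda>x. H (of_real x))"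
      using contour_integral_linepath_Reals_eq[of "-of_real R" "of_real R" H] R0 by simp
    also have "\<dots> = I R" unfolding I_def
      using set_borel_integral_eq_integral(2)[of "{-R..R}" "\<lambda>x. H (of_real x)"]
        borel_integrable_atLeastAtMost'[OF continuous_on_subset[OF contH subset_UNIV]]
      by (simp add: set_lebesgue_integral_def)
    finally show ?thesis .
  qed
  have "(\<lambda>n. I (real n)) \<longlonglongrightarrow> (LINT \<tau>|lborel. H (of_real \<tau>))"
    unfolding I_def
  proof (rule integral_dominated_convergence)
    show "integrable lborel (\<lambda>\<tau>. norm (H (of_real \<tau>)))" using intH by (rule integrable_norm)
    have "((\<lambda>n. indicator {- real n..real n} x *\<^sub>R H (of_real x)) \<longlonglongrightarrow> H (of_real x))" for x
    proof (rule tendsto_eventually)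
      show "\<forall>\<^sub>F n in sequentially. indicator {- real n..real n} x *\<^sub>R H (of_real x) = H (of_real x)"
        using eventually_ge_at_top[of "nat \<lceil>\<bar>x\<bar>\<rceil>"]
      proof eventually_elim
        case (elim n)
        then have "\<bar>x\<bar> \<le> real n" by linarith
        then show ?case by (auto simp: indicator_def)
      qed
    qed
    then show "AE x in lborel. (\<lambda>n. indicator {- real n..real n} x *\<^sub>R H (of_real x)) \<longlonglongrightarrow> H (of_real x)"
      by simp
  qed (use intH in \<open>auto simp: indicator_def\<close>)
  moreover have "(\<lambda>n. I (real n)) \<longlonglongrightarrow> 0"
  proof (rule Lim_null_comparison)
    show "\<forall>\<^sub>F n in sequentially. norm (I (real n)) \<le> 8 * B * pi / real n"
      using eventually_gt_at_top[of "nat \<lceil>2 * norm \<zeta>\<rceil>"]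
      by eventually_elim (intro I_bound, linarith)
    show "(\<lambda>n. 8 * B * pi / real n) \<longlonglongrightarrow> 0"
      by (rule lim_const_over_n)
  qed
  ultimately have "(LINT \<tau>|lborel. H (of_real \<tau>)) = 0" using LIMSEQ_unique by blast
  then have "(LINT \<tau>|lborel. ?P \<tau> * F \<tau> - ?P \<tau> * F \<zeta>) = 0"
    using \<zeta> by (simp add: H_real right_diff_distrib)
  then have "(LINT \<tau>|lborel. ?P \<tau> * F \<tau>) = (LINT \<tau>|lborel. ?P \<tau> * F \<zeta>)"
    using intPF intP by simp
  also have "\<dots> = pi * F \<zeta>"
    using integral_poisson_kernel[OF \<zeta>] by simp
  finally show ?thesis .
qed

subsection \<open>Feynman parametrization\<close>

text \<open>A point of the segment from 1 to w can be real only if x = 0 or w is real; in the second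
  case w > 0, and a convex combination of 1 and w is positive. This is what allows bases to be
  contracted to 1 without meeting the branch cut.\<close>

lemma slit_plane_star_shaped:
  fixes w :: complex
  assumes "w \<notin> \<real>\<^sub>\<le>\<^sub>0" "0 \<le> x" "x \<le> 1"
  shows "1 + of_real x * (w - 1) \<notin> \<real>\<^sub>\<le>\<^sub>0"
proof
  assume "1 + of_real x * (w - 1) \<in> \<real>\<^sub>\<le>\<^sub>0"
  then have *: "1 + x * (Re w - 1) \<le> 0" "x * Im w = 0"
    by (auto simp: complex_nonpos_Reals_iff)
  then have "x \<noteq> 0" by auto
  with * assms have "Re w > 0" by (auto simp: complex_nonpos_Reals_iff not_le)
  then have "(1 - x) + x * Re w > 0"
    using assms \<open>x \<noteq> 0\<close> by (intro add_nonneg_pos) auto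
  with * show False by (simp add: algebra_simps)
qed

section \<open>The unnormalised Beta density on the unit interval\<close>

definition beta_weight :: "real \<Rightarrow> real \<Rightarrow> real \<Rightarrow> real" where
  "beta_weight a b r = r powr (a - 1) * (1 - r) powr (b - 1)"

lemma borel_measurable_beta_weight [measurable]: "beta_weight a b \<in> borel_measurable borel"
  unfolding beta_weight_def by measurable

lemma beta_weight_nonneg [simp]: "beta_weight a b r \<ge> 0"
  by (simp add: beta_weight_def)

text \<open>At the endpoints this relies on \<open>0 powr x = 0\<close>, valid for every real \<open>x\<close>.\<close>

lemma beta_weight_Ioo_Icc:
  "indicator {0<..<1} r *\<^sub>R beta_weight a b r = indicator {0..1} r *\<^sub>R beta_weight a b r"
  by (auto simp: beta_weight_def indicator_def)

lemma
  assumes "a > 0" "b > 0"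
  shows set_integrable_beta_weight: "set_integrable lborel {0<..<1} (beta_weight a b)"
    and set_integral_beta_weight: "(LINT r:{0<..<1}|lborel. beta_weight a b r) = Beta a b"
proof -
  have i: "set_integrable lborel {0..1} (beta_weight a b)"
    using integrable_Beta[OF assms] by (simp add: beta_weight_def[abs_def])
  then show "set_integrable lborel {0<..<1} (beta_weight a b)"
    by (simp only: set_integrable_def beta_weight_Ioo_Icc)
  have "(LINT r:{0<..<1}|lborel. beta_weight a b r) = (LINT r:{0..1}|lborel. beta_weight a b r)"
    by (simp only: set_lebesgue_integral_def beta_weight_Ioo_Icc)
  also have "\<dots> = Beta a b"
    using set_borel_integral_eq_integral(2)[OF i] integral_unique[OF has_integral_Beta_real[OF assms]]
    by (simp add: beta_weight_def[abs_def])
  finally show "(LINT r:{0<..<1}|lborel. beta_weight a b r) = Beta a b" .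
qed

text \<open>The weight is unbounded at an endpoint whose exponent is negative, so the weight itself
  serves as majorant; continuity of G up to the endpoints supplies the constant factor.\<close>

lemma set_integrable_beta_weight_times:
  fixes G :: "real \<Rightarrow> complex"
  assumes ab: "a > 0" "b > 0" and G: "continuous_on {0..1} G"
  shows "set_integrable lborel {0<..<1} (\<lambda>r. of_real (beta_weight a b r) * G r)"
proof -
  obtain C where C: "\<And>r. r \<in> {0..1} \<Longrightarrow> norm (G r) \<le> C"
    using compact_imp_bounded[OF compact_continuous_image[OF G compact_Icc]]
    unfolding bounded_iff by blast
  show ?thesis unfolding set_integrable_def
  proof (rule Bochner_Integration.integrable_bound)
    show "integrable lborel (\<lambda>r. C * (indicator {0<..<1} r *\<^sub>R beta_weight a b r))"
      using set_integrable_beta_weight[OF ab] unfolding set_integrable_def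
      by (rule integrable_mult_right)
    have [measurable]: "(\<lambda>r. indicator {0<..<1} r *\<^sub>R G r) \<in> borel_measurable borel"
      by (intro borel_measurable_continuous_on_indicator continuous_on_subset[OF G]) auto
    have "(\<lambda>r. of_real (beta_weight a b r) * (indicator {0<..<1} r *\<^sub>R G r)) \<in> borel_measurable lborel"
      by measurable
    then show "(\<lambda>r. indicator {0<..<1} r *\<^sub>R (of_real (beta_weight a b r) * G r)) \<in> borel_measurable lborel"
      by simp
    show "AE r in lborel. norm (indicator {0<..<1} r *\<^sub>R (of_real (beta_weight a b r) * G r))
            \<le> norm (C * (indicator {0<..<1} r *\<^sub>R beta_weight a b r))"
    proof (rule AE_I2)
      fix r :: real
      have "C \<ge> 0" using order_trans[OF norm_ge_zero C[of 0]] by simp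
      then show "norm (indicator {0<..<1} r *\<^sub>R (of_real (beta_weight a b r) * G r))
            \<le> norm (C * (indicator {0<..<1} r *\<^sub>R beta_weight a b r))"
        using C[of r] by (auto simp: indicator_def norm_mult abs_mult mult.commute[of C] intro!: mult_left_mono)
    qed
  qed
qed

text \<open>Lets powers whose exponents differ by 1 be written with one common factor, so that the
  derivative identities below become polynomial identities.\<close>

lemma powr_eq_powr_minus_1_times:
  fixes w :: complex assumes "w \<noteq> 0" shows "w powr s = w powr (s - 1) * w"
  using assms by (simp add: powr_diff)

lemma continuous_on_powr_slit_plane:
  fixes f :: "'a::topological_space \<Rightarrow> complex"
  assumes "continuous_on S f" "\<And>x. x \<in> S \<Longrightarrow> f x \<notin> \<real>\<^sub>\<le>\<^sub>0"
  shows "continuous_on S (\<lambda>x. f x powr c)"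
  by (intro continuous_on_powr_complex continuous_on_const)
     (use assms in \<open>force simp: complex_nonpos_Reals_iff\<close>)+

text \<open>
  Along the segments $A(x) = 1 + x(A-1)$, $B(x) = 1 + x(B-1)$ with $D = rA(x) + (1-r)B(x)$, the
  $x$-derivative of $A(x)^a B(x)^b D^{-a-b}$, weighted by $r^{a-1}(1-r)^{b-1}$, is a function of $x$
  times the $r$-derivative of $r^a (1-r)^b D^{-a-b}$, whose integral over $(0,1)$ vanishes. Hence the
  parameter integral does not depend on $x$.
\<close>
theorem feynman_parametrization:
  fixes A B :: complex and a b :: real
  assumes ab: "a > 0" "b > 0"
    and seg: "\<And>r. 0 \<le> r \<Longrightarrow> r \<le> 1 \<Longrightarrow> of_real r * A + of_real (1 - r) * B \<notin> \<real>\<^sub>\<le>\<^sub>0"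
  shows "(LINT r:{0<..<1}|lborel. of_real (beta_weight a b r) *
            (of_real r * A + of_real (1 - r) * B) powr (- of_real (a + b)))
          = of_real (Beta a b) * (A powr (- of_real a) * B powr (- of_real b))"
proof -
  define W where "W = (\<lambda>r. of_real r * A + of_real (1 - r) * B)"
  define Ax where "Ax = (\<lambda>x. 1 + complex_of_real x * (A - 1))"
  define Bx where "Bx = (\<lambda>x. 1 + complex_of_real x * (B - 1))"
  define D where "D = (\<lambda>x r. 1 + complex_of_real x * (W r - 1))"
  have WA: "W 1 = A" and WB: "W 0 = B" by (simp_all add: W_def)
  have D_slit: "D x r \<notin> \<real>\<^sub>\<le>\<^sub>0" if "x \<in> {0..1}" "r \<in> {0..1}" for x r
    unfolding D_def W_def using that by (intro slit_plane_star_shaped seg) auto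
  have A_slit: "Ax x \<notin> \<real>\<^sub>\<le>\<^sub>0" and B_slit: "Bx x \<notin> \<real>\<^sub>\<le>\<^sub>0" if "x \<in> {0..1}" for x
    using D_slit[OF that, of 1] D_slit[OF that, of 0] by (auto simp: D_def Ax_def Bx_def WA WB)
  have nz: "w \<noteq> 0" if "w \<notin> \<real>\<^sub>\<le>\<^sub>0" for w :: complex using that by auto
  \<comment> \<open>Mixing with weights r, 1 - r and contracting towards 1 are both affine, so they
    commute. The form defining \<open>D\<close> suits the x-derivative, this one the
    r-derivative.\<close>
  have D_eq: "D x r = of_real r * Ax x + of_real (1 - r) * Bx x" for x r
    by (simp add: D_def W_def Ax_def Bx_def algebra_simps)

  \<comment> \<open>At x = 0 all bases are 1 and \<Phi> is 1, which gives the Beta integral; at x =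
    1 it is the wanted integrand times A^a B^b. The x-derivative of \<Phi> splits into
    \<open>K\<close>, free of r, and \<open>G\<close>, for which \<Psi> is an r-antiderivative of
    \<open>G\<close> times the weight.\<close>
  define \<Phi> where "\<Phi> = (\<lambda>x r. Ax x powr of_real a * Bx x powr of_real b * D x r powr (- of_real (a + b)))"
  define K where "K = (\<lambda>x. Ax x powr (of_real a - 1) * Bx x powr (of_real b - 1) * (A - B))"
  define G where "G = (\<lambda>x r. D x r powr (- of_real (a + b) - 1) *
                     (of_real (a * (1 - r)) * Bx x - of_real (b * r) * Ax x))"
  define \<Psi> where "\<Psi> = (\<lambda>x r. of_real (r powr a * (1 - r) powr b) * D x r powr (- of_real (a + b)))"

  have d\<Phi>: "((\<lambda>x. \<Phi> x r) has_vector_derivative K x * G x r) (at x)"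
    if x: "x \<in> {0..1}" and r: "r \<in> {0..1}" for x r
  proof -
    let ?E = "Ax x powr of_real a * Bx x powr of_real b *
           ((- of_real (a + b)) * D x r powr (- of_real (a + b) - 1) * (W r - 1))
       + (Ax x powr of_real a * (of_real b * Bx x powr (of_real b - 1) * (B - 1))
          + (of_real a * Ax x powr (of_real a - 1) * (A - 1)) * Bx x powr of_real b) * D x r powr (- of_real (a + b))"
    have "((\<lambda>x. \<Phi> x r) has_vector_derivative ?E) (at x)"
      unfolding \<Phi>_def
    proof (intro has_vector_derivative_mult)
      have pow: "((\<lambda>x. (1 + of_real x * c) powr s) has_vector_derivative s * (1 + of_real x * c) powr (s - 1) * c) (at x)"
        if "1 + of_real x * c \<notin> \<real>\<^sub>\<le>\<^sub>0" for c s :: complex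
        by (intro has_vector_derivative_real_field DERIV_chain2[OF has_field_derivative_powr])
           (use that in \<open>auto intro!: derivative_eq_intros\<close>)
      show "((\<lambda>x. Ax x powr of_real a) has_vector_derivative of_real a * Ax x powr (of_real a - 1) * (A - 1)) (at x)"
        using pow A_slit[OF x] unfolding Ax_def by blast
      show "((\<lambda>x. Bx x powr of_real b) has_vector_derivative of_real b * Bx x powr (of_real b - 1) * (B - 1)) (at x)"
        using pow B_slit[OF x] unfolding Bx_def by blast
      show "((\<lambda>x. D x r powr (- of_real (a + b))) has_vector_derivative
          - of_real (a + b) * D x r powr (- of_real (a + b) - 1) * (W r - 1)) (at x)"
        using pow D_slit[OF x r] unfolding D_def by blast
    qed
    moreover have "?E = K x * G x r"
    proof -
      define P where "P = Ax x powr (of_real a - 1)"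
      define Q where "Q = Bx x powr (of_real b - 1)"
      define E where "E = D x r powr (- of_real (a + b) - 1)"
      have "Ax x powr of_real a = P * Ax x" "Bx x powr of_real b = Q * Bx x"
        "D x r powr (- of_real (a + b)) = E * D x r"
        unfolding P_def Q_def E_def
        by (rule powr_eq_powr_minus_1_times, use A_slit B_slit D_slit x r nz in blast)+
      moreover have "P * Ax x * (Q * Bx x) * (- of_real (a + b) * E * (W r - 1))
          + (P * Ax x * (of_real b * Q * (B - 1)) + of_real a * P * (A - 1) * (Q * Bx x)) * (E * D x r)
         = P * Q * (A - B) * (E * (of_real (a * (1 - r)) * Bx x - of_real (b * r) * Ax x))"
        unfolding D_def W_def Ax_def Bx_def by (simp, algebra)
      ultimately show ?thesis
        by (simp add: K_def G_def P_def Q_def E_def)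
    qed
    ultimately show ?thesis by simp
  qed

  have d\<Psi>: "((\<Psi> x) has_vector_derivative of_real (beta_weight a b r) * G x r) (at r)"
    if x: "x \<in> {0..1}" and r: "r \<in> {0<..<1}" for x r
  proof -
    let ?E = "of_real (r powr a * (1 - r) powr b) *
           ((- of_real (a + b)) * D x r powr (- of_real (a + b) - 1) * (Ax x - Bx x))
       + of_real (r powr a * (- (b * (1 - r) powr (b - 1))) + (a * r powr (a - 1)) * (1 - r) powr b)
          * D x r powr (- of_real (a + b))"
    have "((\<Psi> x) has_vector_derivative ?E) (at r)"
      unfolding \<Psi>_def
    proof (intro has_vector_derivative_mult)
      show "((\<lambda>r. complex_of_real (r powr a * (1 - r) powr b)) has_vector_derivative
         of_real (r powr a * (- (b * (1 - r) powr (b - 1))) + (a * r powr (a - 1)) * (1 - r) powr b)) (at r)"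
        by (intro has_vector_derivative_of_real) (use r in \<open>auto intro!: derivative_eq_intros simp: powr_diff field_simps\<close>)
      have "((\<lambda>w. (w * Ax x + (1 - w) * Bx x) powr (- of_real (a + b))) has_field_derivative
          (- of_real (a + b)) * (of_real r * Ax x + (1 - of_real r) * Bx x) powr (- of_real (a + b) - 1)
             * (Ax x - Bx x)) (at (of_real r))"
        by (intro DERIV_chain2[OF has_field_derivative_powr])
           (use D_slit[OF x, of r] r in \<open>auto simp: D_eq intro!: derivative_eq_intros\<close>)
      then show "((\<lambda>r. D x r powr (- of_real (a + b))) has_vector_derivative
          - of_real (a + b) * D x r powr (- of_real (a + b) - 1) * (Ax x - Bx x)) (at r)"
        unfolding D_eq of_real_diff of_real_1 by (rule has_vector_derivative_real_field)
    qed
    moreover have "?E = of_real (beta_weight a b r) * G x r"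
    proof -
      define P where "P = complex_of_real (r powr (a - 1))"
      define Q where "Q = complex_of_real ((1 - r) powr (b - 1))"
      define E where "E = D x r powr (- of_real (a + b) - 1)"
      have "complex_of_real (r powr a) = P * of_real r" "complex_of_real ((1 - r) powr b) = Q * (1 - of_real r)"
        using r by (simp_all add: P_def Q_def powr_diff)
      moreover have "D x r powr (- of_real (a + b)) = E * D x r"
        unfolding E_def
        by (rule powr_eq_powr_minus_1_times) (use D_slit x r nz in force)
      moreover have "P * of_real r * (Q * (1 - of_real r)) * (- of_real (a + b) * E * (Ax x - Bx x))
           + (P * of_real r * (- (of_real b * Q)) + (of_real a * P) * (Q * (1 - of_real r))) * (E * D x r)
         = P * Q * (E * (of_real (a * (1 - r)) * Bx x - of_real (b * r) * Ax x))"
        unfolding D_eq by (simp, algebra)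
      ultimately show ?thesis
        by (simp add: beta_weight_def G_def P_def Q_def E_def)
    qed
    ultimately show ?thesis by simp
  qed

  have cG: "continuous_on ({0..1} \<times> {0..1}) (\<lambda>p. G (fst p) (snd p))"
    unfolding G_def
    by (intro continuous_on_mult continuous_on_powr_slit_plane)
       (use D_slit in \<open>auto simp: D_def W_def Ax_def Bx_def intro!: continuous_intros\<close>)
  have cK: "continuous_on {0..1} K"
    unfolding K_def
    by (intro continuous_on_mult continuous_on_powr_slit_plane)
       (use A_slit B_slit in \<open>auto simp: Ax_def Bx_def intro!: continuous_intros\<close>)
  have cG1: "continuous_on {0..1} (G x)" if "x \<in> {0..1}" for x
  proof -
    have "continuous_on {0..1} (\<lambda>r::real. (x, r))" by (intro continuous_intros)
    from continuous_on_compose2[OF cG this] show ?thesis using that by force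
  qed
  have cG2: "continuous_on {0..1} (\<lambda>x. G x r)" if "r \<in> {0..1}" for r
  proof -
    have "continuous_on {0..1} (\<lambda>x::real. (x, r))" by (intro continuous_intros)
    from continuous_on_compose2[OF cG this] show ?thesis using that by force
  qed
  have cKG: "continuous_on ({0..1} \<times> {0..1}) (\<lambda>p. K (fst p) * G (fst p) (snd p))"
    by (intro continuous_on_mult cG continuous_on_compose2[OF cK]) (auto intro!: continuous_intros)
  obtain C where C: "\<And>x r. x \<in> {0..1} \<Longrightarrow> r \<in> {0..1} \<Longrightarrow> norm (K x * G x r) \<le> C"
    using compact_imp_bounded[OF compact_continuous_image[OF cKG]]
    unfolding bounded_iff by (fastforce simp: compact_Times)
  have C0: "C \<ge> 0" using order_trans[OF norm_ge_zero C[of 0 0]] by simp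

  \<comment> \<open>This is the weighted x-derivative of \<Phi>, cut off to the unit square.
    Integrated over r it gives 0, integrated over x it gives the difference of \<Phi> at the two
    ends. Comparing the two orders by Fubini replaces differentiation under the integral
    sign.\<close>
  define f where "f = (\<lambda>x r. indicator {0..1} x *\<^sub>R (indicator {0<..<1} r *\<^sub>R
                         (complex_of_real (beta_weight a b r) * (K x * G x r))))"
  have "integrable (lborel \<Otimes>\<^sub>M lborel) (\<lambda>p. f (fst p) (snd p))"
  proof (rule Bochner_Integration.integrable_bound)
    show "integrable (lborel \<Otimes>\<^sub>M lborel) (\<lambda>p::real \<times> real. C * (indicator {0..1} (fst p) *
             (indicator {0<..<1} (snd p) *\<^sub>R beta_weight a b (snd p))))"
      using lborel_pair.integrable_fst_times_snd[of "indicator {0..1} :: real \<Rightarrow> real"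
          "\<lambda>r. indicator {0<..<1} r *\<^sub>R beta_weight a b r"] set_integrable_beta_weight[OF ab]
      unfolding set_integrable_def by simp
    have [measurable]: "(\<lambda>p. indicator ({0..1} \<times> {0..1}) p *\<^sub>R (K (fst p) * G (fst p) (snd p)))
            \<in> borel_measurable (lborel \<Otimes>\<^sub>M lborel)"
      unfolding lborel_prod measurable_lborel2
      by (intro borel_measurable_continuous_on_indicator cKG) (simp add: borel_closed closed_Times)
    have f_eq: "(\<lambda>p. f (fst p) (snd p)) = (\<lambda>p. of_real (indicator {0<..<1} (snd p) * beta_weight a b (snd p))
            * (indicator ({0..1} \<times> {0..1}) p *\<^sub>R (K (fst p) * G (fst p) (snd p))))"
      by (auto simp: f_def indicator_def fun_eq_iff)
    show "(\<lambda>p. f (fst p) (snd p)) \<in> borel_measurable (lborel \<Otimes>\<^sub>M lborel)"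
      unfolding f_eq by measurable
    show "AE p::real \<times> real in lborel \<Otimes>\<^sub>M lborel. norm (f (fst p) (snd p)) \<le> norm (C * (indicator {0..1} (fst p) *
             (indicator {0<..<1} (snd p) *\<^sub>R beta_weight a b (snd p))))"
    proof (rule AE_I2)
      fix p :: "real \<times> real"
      show "norm (f (fst p) (snd p)) \<le> norm (C * (indicator {0..1} (fst p) *
             (indicator {0<..<1} (snd p) *\<^sub>R beta_weight a b (snd p))))"
        using C[of "fst p" "snd p"] C0
        by (auto simp: f_def indicator_def norm_mult abs_mult mult.commute[of C] intro!: mult_left_mono)
    qed
  qed
  then have int_f: "integrable (lborel \<Otimes>\<^sub>M lborel) (\<lambda>(x, r). f x r)"
    by (simp add: case_prod_beta')
  have \<Psi>_int: "(LINT r:{0<..<1}|lborel. of_real (beta_weight a b r) * G x r) = 0" if x: "x \<in> {0..1}" for x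
  proof -
    have c\<Psi>: "continuous_on {0..1} (\<Psi> x)"
      unfolding \<Psi>_def
      by (intro continuous_on_mult continuous_on_of_real continuous_on_powr' continuous_on_powr_slit_plane)
         (use D_slit x ab in \<open>auto simp: D_def W_def intro!: continuous_intros\<close>)
    \<comment> \<open>The integrand may blow up at the ends, so the fundamental theorem is applied
      on the open interval. The limits of \<Psi> are 0 because r^a and (1-r)^b have positive
      exponents.\<close>
    have "(LBINT r=0..1. of_real (beta_weight a b r) * G x r) = 0 - 0"
    proof (rule interval_integral_FTC_integrable[where F = "\<Psi> x"])
      show "(\<Psi> x has_vector_derivative of_real (beta_weight a b r) * G x r) (at r)"
        if "0 < ereal r" "ereal r < 1" for r
        using d\<Psi>[OF x, of r] that by (simp add: zero_ereal_def one_ereal_def)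
      show "isCont (\<lambda>r. of_real (beta_weight a b r) * G x r) r" if "0 < ereal r" "ereal r < 1" for r
      proof -
        have r: "r \<in> {0<..<1}" using that by (simp add: zero_ereal_def one_ereal_def)
        have "isCont (G x) r"
          using continuous_on_interior[OF cG1[OF x], of r] r by simp
        then show ?thesis using r unfolding beta_weight_def
          by (intro continuous_intros) auto
      qed
      show "set_integrable lborel (einterval 0 1) (\<lambda>r. of_real (beta_weight a b r) * G x r)"
        using set_integrable_beta_weight_times[OF ab cG1[OF x]] by (simp add: zero_ereal_def one_ereal_def)
      have "(\<Psi> x \<longlongrightarrow> \<Psi> x 0) (at_right 0)" "(\<Psi> x \<longlongrightarrow> \<Psi> x 1) (at_left 1)"
        using c\<Psi> by (auto intro: continuous_on_Icc_at_rightD continuous_on_Icc_at_leftD)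
      then show "((\<Psi> x \<circ> real_of_ereal) \<longlongrightarrow> 0) (at_right 0)" "((\<Psi> x \<circ> real_of_ereal) \<longlongrightarrow> 0) (at_left 1)"
        by (simp_all add: zero_ereal_def one_ereal_def ereal_tendsto_simps \<Psi>_def)
    qed simp
    then show ?thesis
      by (simp add: interval_lebesgue_integral_def zero_ereal_def one_ereal_def)
  qed
  have "(LINT r|lborel. f x r) = 0" for x
  proof (cases "x \<in> {0..1}")
    case True
    then have "(LINT r|lborel. f x r) =
        (LINT r|lborel. K x * (indicator {0<..<1} r *\<^sub>R (of_real (beta_weight a b r) * G x r)))"
      by (intro Bochner_Integration.integral_cong) (auto simp: f_def indicator_def)
    also have "\<dots> = K x * (LINT r:{0<..<1}|lborel. of_real (beta_weight a b r) * G x r)"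
      unfolding set_lebesgue_integral_def by (rule integral_mult_right_zero)
    finally show ?thesis using \<Psi>_int[OF True] by simp
  qed (simp add: f_def)
  then have "(LINT r|lborel. (LINT x|lborel. f x r)) = 0"
    using lborel_pair.Fubini_integral[OF int_f] by simp
  moreover have "(LINT x|lborel. f x r) =
      indicator {0<..<1} r *\<^sub>R (of_real (beta_weight a b r) * (A powr of_real a * B powr of_real b * W r powr (- of_real (a + b)) - 1))"
    for r
  proof (cases "r \<in> {0<..<1}")
    case True
    have "(LINT x|lborel. f x r) =
        (LINT x|lborel. of_real (beta_weight a b r) * (indicator {0..1} x *\<^sub>R (K x * G x r)))"
      using True by (intro Bochner_Integration.integral_cong) (auto simp: f_def indicator_def)
    also have "\<dots> = of_real (beta_weight a b r) * (LINT x|lborel. indicator {0..1} x *\<^sub>R (K x * G x r))"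
      by (rule integral_mult_right_zero)
    also have "(LINT x|lborel. indicator {0..1} x *\<^sub>R (K x * G x r)) = \<Phi> 1 r - \<Phi> 0 r"
    proof (rule integral_FTC_atLeastAtMost)
      show "((\<lambda>x. \<Phi> x r) has_vector_derivative K x * G x r) (at x within {0..1})" if "0 \<le> x" "x \<le> 1" for x
        using d\<Phi>[of x r] that True by (simp add: has_vector_derivative_at_within)
      show "continuous_on {0..1} (\<lambda>x. K x * G x r)"
        using True by (intro continuous_on_mult cK cG2) simp
    qed simp
    also have "\<dots> = A powr of_real a * B powr of_real b * W r powr (- of_real (a + b)) - 1"
      by (simp add: \<Phi>_def Ax_def Bx_def D_def)
    finally show ?thesis using True by simp
  qed (simp add: f_def)
  ultimately have "(LINT r:{0<..<1}|lborel. of_real (beta_weight a b r) *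
         (A powr of_real a * B powr of_real b * W r powr (- of_real (a + b)) - 1)) = 0"
    by (simp add: set_lebesgue_integral_def)
  moreover have cW: "continuous_on {0..1} (\<lambda>r. W r powr (- of_real (a + b)))"
    by (rule continuous_on_powr_slit_plane) (use seg in \<open>auto simp: W_def intro!: continuous_intros\<close>)
  note iW = set_integrable_beta_weight_times[OF ab cW]
  have i1: "set_integrable lborel {0<..<1} (\<lambda>r. complex_of_real (beta_weight a b r))"
    using set_integrable_beta_weight_times[OF ab, of "\<lambda>_. 1"] by simp
  have "(LINT r:{0<..<1}|lborel. of_real (beta_weight a b r) *
         (A powr of_real a * B powr of_real b * W r powr (- of_real (a + b)) - 1))
      = (LINT r:{0<..<1}|lborel. A powr of_real a * B powr of_real b * (of_real (beta_weight a b r) * W r powr (- of_real (a + b)))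
           - of_real (beta_weight a b r))"
    by (simp add: algebra_simps)
  also have "\<dots> = A powr of_real a * B powr of_real b *
        (LINT r:{0<..<1}|lborel. of_real (beta_weight a b r) * W r powr (- of_real (a + b)))
        - (LINT r:{0<..<1}|lborel. of_real (beta_weight a b r))"
    by (subst set_integral_diff(2)[OF set_integrable_mult_right[OF iW] i1]) simp
  also have "(LINT r:{0<..<1}|lborel. of_real (beta_weight a b r)) = complex_of_real (Beta a b)"
    by (simp add: set_integral_complex_of_real set_integral_beta_weight[OF ab])
  ultimately have "A powr of_real a * B powr of_real b *
        (LINT r:{0<..<1}|lborel. of_real (beta_weight a b r) * W r powr (- of_real (a + b))) = of_real (Beta a b)"
    by simp
  moreover have "A powr of_real a \<noteq> 0" "B powr of_real b \<noteq> 0"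
    using nz[OF A_slit[of 1]] nz[OF B_slit[of 1]] by (auto simp: Ax_def Bx_def)
  ultimately show ?thesis
    unfolding W_def by (simp add: powr_minus field_simps)
qed

subsection \<open>Mixtures of Cayley transforms\<close>

text \<open>Both arguments lie in (0, pi), so their difference lies in (-pi, pi) and the principal
  logarithm of the quotient needs no correction by 2 pi i.\<close>

lemma powr_divide_upper_half_plane:
  assumes "Im u > 0" "Im v > 0"
  shows "(u / v) powr s = u powr s / v powr s"
proof -
  have nz: "u \<noteq> 0" "v \<noteq> 0" using assms by auto
  have v: "Ln (inverse v) = - Ln v"
    using assms by (intro Ln_inverse) (auto simp: complex_nonpos_Reals_iff)
  have "Ln (u * inverse v) = Ln u + Ln (inverse v)"
    using Im_Ln_pos_lt_imp[OF assms(1)] Im_Ln_pos_lt_imp[OF assms(2)] nz v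
    by (intro Ln_times_simple) auto
  then have "Ln (u / v) = Ln u - Ln v"
    by (simp add: divide_inverse v)
  then show ?thesis
    using nz by (simp add: powr_def right_diff_distrib exp_diff)
qed

text \<open>
  The map $w \mapsto 1/(w+\mathrm i)$ takes the closed upper half-plane onto a disc through $0$, punctured
  at $0$; its convexity is what makes the mixture of Cayley transforms stay in the half-plane.
\<close>

abbreviation inv_disc :: "complex set" where
  "inv_disc \<equiv> cball (- \<i> / 2) (1 / 2)"

lemma inv_disc_iff: "p \<in> inv_disc \<longleftrightarrow> (Re p)\<^sup>2 + (Im p)\<^sup>2 \<le> - Im p"
proof -
  have "p \<in> inv_disc \<longleftrightarrow> (norm (p + \<i> / 2))\<^sup>2 \<le> (1/2)\<^sup>2"
    by (subst power_mono_iff) (auto simp: dist_norm norm_minus_commute algebra_simps)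
  also have "\<dots> \<longleftrightarrow> (Re p)\<^sup>2 + (Im p)\<^sup>2 \<le> - Im p"
    unfolding cmod_power2 by (auto simp: power2_eq_square algebra_simps)
  finally show ?thesis .
qed

lemma Re_Im_inverse_plus_ii:
  shows "(Re (1 / (w + \<i>)))\<^sup>2 + (Im (1 / (w + \<i>)))\<^sup>2 = 1 / ((Re w)\<^sup>2 + (Im w + 1)\<^sup>2)"
    and "- Im (1 / (w + \<i>)) = (Im w + 1) / ((Re w)\<^sup>2 + (Im w + 1)\<^sup>2)"
proof -
  have "(norm (1 / (w + \<i>)))\<^sup>2 = 1 / ((Re w)\<^sup>2 + (Im w + 1)\<^sup>2)"
    by (simp add: norm_divide power_divide cmod_power2)
  then show "(Re (1 / (w + \<i>)))\<^sup>2 + (Im (1 / (w + \<i>)))\<^sup>2 = 1 / ((Re w)\<^sup>2 + (Im w + 1)\<^sup>2)"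
    by (simp only: cmod_power2)
  show "- Im (1 / (w + \<i>)) = (Im w + 1) / ((Re w)\<^sup>2 + (Im w + 1)\<^sup>2)"
    by (simp add: Im_divide power2_eq_square minus_divide_left)
qed

lemma inverse_plus_ii_in_inv_disc:
  assumes "Im w \<ge> 0"
  shows "1 / (w + \<i>) \<in> inv_disc"
  unfolding inv_disc_iff Re_Im_inverse_plus_ii using assms by (simp add: divide_right_mono)

text \<open>The quantity equals (w + z)/(w + i). If it were -k with k \<ge> 0, then w + z = -k(w +
  i), where the left side has positive and the right side nonpositive imaginary part. The bound -min
  (Im z) 1 keeps both w + z and w + i in the open upper half-plane, and it leaves a strip below the
  real axis as \<open>poisson_half_plane\<close> requires.\<close>

lemma quotient_notin_slit:
  assumes "Im w > - min (Im z) 1" "Im z > 0"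
  shows "1 + (z - \<i>) / (w + \<i>) \<notin> \<real>\<^sub>\<le>\<^sub>0"
proof
  define X where "X = 1 + (z - \<i>) / (w + \<i>)"
  define k where "k = - Re X"
  assume "1 + (z - \<i>) / (w + \<i>) \<in> \<real>\<^sub>\<le>\<^sub>0"
  then have k: "k \<ge> 0" "X = - of_real k"
    unfolding X_def[symmetric] by (auto simp: complex_nonpos_Reals_iff complex_eq_iff k_def)
  have "w + \<i> \<noteq> 0" using assms by (auto simp: complex_eq_iff)
  then have "(w + \<i>) + (z - \<i>) = - of_real k * (w + \<i>)"
    using k(2) by (simp add: X_def field_simps)
  then have "Im w + Im z + k * (Im w + 1) = 0"
    by (simp add: complex_eq_iff)
  moreover have "Im w + Im z > 0" "k * (Im w + 1) \<ge> 0"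
    using assms k by auto
  ultimately show False by linarith
qed

text \<open>Substituting w = 1/p - i reduces this to the closed half-plane. The point p = 0 stands
  for w at infinity, where the value is 1.\<close>

lemma affine_inv_disc_notin_slit:
  assumes "p \<in> inv_disc" "Im z > 0"
  shows "1 + (z - \<i>) * p \<notin> \<real>\<^sub>\<le>\<^sub>0"
proof (cases "p = 0")
  case False
  have pos: "(Re p)\<^sup>2 + (Im p)\<^sup>2 > 0"
    using False by (simp add: complex_eq_iff sum_power2_gt_zero_iff)
  have "Im (1 / p - \<i>) \<ge> 0"
    using assms(1) pos unfolding inv_disc_iff by (simp add: Im_divide field_simps)
  then show ?thesis
    using quotient_notin_slit[of z "1 / p - \<i>"] assms False by (simp add: field_simps)
qed auto

definition cayley_mix :: "real \<Rightarrow> real \<Rightarrow> real \<Rightarrow> complex" where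
  "cayley_mix s t r = cayley_inv (of_real r * cayley (of_real s) + of_real (1 - r) * cayley (of_real t))"

text \<open>This is strict convexity of the disc: distinct real points go to distinct points of its
  boundary circle, and a proper mixture of those lies in the interior. The formula cayley w = 1 -
  2i/(w + i) carries the mixture over to the points 1/(w + i).\<close>

lemma cayley_mix:
  assumes "s \<noteq> t" "0 < r" "r < 1"
  shows Im_cayley_mix: "Im (cayley_mix s t r) > 0"
    and inverse_cayley_mix: "1 / (cayley_mix s t r + \<i>)
           = of_real r * (1 / (of_real s + \<i>)) + of_real (1 - r) * (1 / (of_real t + \<i>))"
proof -
  define a b where "a = 1 / (complex_of_real s + \<i>)" and "b = 1 / (complex_of_real t + \<i>)"
  define p where "p = of_real r * a + of_real (1 - r) * b"
  \<comment> \<open>Real points are sent to the boundary circle, hence equality.\<close>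
  have ab: "(Re a)\<^sup>2 + (Im a)\<^sup>2 = - Im a" "(Re b)\<^sup>2 + (Im b)\<^sup>2 = - Im b"
    using Re_Im_inverse_plus_ii[of "of_real s"] Re_Im_inverse_plus_ii[of "of_real t"] by (simp_all add: a_def b_def)
  have nz: "complex_of_real s + \<i> \<noteq> 0" "complex_of_real t + \<i> \<noteq> 0" by (auto simp: complex_eq_iff)
  then have "a \<noteq> b" using assms by (auto simp: a_def b_def field_simps)
  then have "(Re a - Re b)\<^sup>2 + (Im a - Im b)\<^sup>2 > 0"
    by (auto simp: complex_eq_iff sum_power2_gt_zero_iff)
  then have "r * (1 - r) * ((Re a - Re b)\<^sup>2 + (Im a - Im b)\<^sup>2) > 0"
    using assms by (intro mult_pos_pos) auto
  \<comment> \<open>The subtracted term is the variance of the two-point distribution on a, b with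
    weights r, 1 - r; it is the slack that puts p strictly inside the disc.\<close>
  moreover have "(Re p)\<^sup>2 + (Im p)\<^sup>2 = r * ((Re a)\<^sup>2 + (Im a)\<^sup>2) + (1 - r) * ((Re b)\<^sup>2 + (Im b)\<^sup>2)
      - r * (1 - r) * ((Re a - Re b)\<^sup>2 + (Im a - Im b)\<^sup>2)"
    by (simp add: p_def power2_eq_square algebra_simps)
  moreover have "- Im p = r * (- Im a) + (1 - r) * (- Im b)"
    by (simp add: p_def)
  ultimately have lt: "(Re p)\<^sup>2 + (Im p)\<^sup>2 < - Im p"
    using ab by simp
  then have p0: "p \<noteq> 0" by auto
  have pos: "(Re p)\<^sup>2 + (Im p)\<^sup>2 > 0"
    using p0 by (simp add: complex_eq_iff sum_power2_gt_zero_iff)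
  have cay: "cayley (of_real s) = 1 - 2 * \<i> * a" "cayley (of_real t) = 1 - 2 * \<i> * b"
    using nz by (simp_all add: cayley_def a_def b_def field_simps)
  have mix_eq: "of_real r * cayley (of_real s) + of_real (1 - r) * cayley (of_real t) = 1 - 2 * \<i> * p"
    unfolding cay p_def by (simp add: algebra_simps)
  have "\<i> * (1 + (1 - 2 * \<i> * p)) / (1 - (1 - 2 * \<i> * p)) = 1 / p - \<i>"
    using p0 by (simp add: field_simps)
  then have mix: "cayley_mix s t r = 1 / p - \<i>"
    unfolding cayley_mix_def cayley_inv_def mix_eq .
  show "Im (cayley_mix s t r) > 0"
    unfolding mix using lt pos by (simp add: Im_divide field_simps)
  show "1 / (cayley_mix s t r + \<i>) = of_real r * (1 / (of_real s + \<i>)) + of_real (1 - r) * (1 / (of_real t + \<i>))"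
    unfolding mix using p0 by (simp add: p_def a_def b_def)
qed

text \<open>The function q of the overview. Writing it as a single power of a base that is affine in
  1/(w + i) lets mixtures pass directly to the base.\<close>

definition kernel_quot :: "complex \<Rightarrow> real \<Rightarrow> complex \<Rightarrow> complex" where
  "kernel_quot z \<alpha> w = (1 + (z - \<i>) / (w + \<i>)) powr (- of_real \<alpha>)"

lemma kernel_quot_holomorphic:
  assumes "Im z > 0"
  shows "kernel_quot z \<alpha> holomorphic_on {w. Im w > - min (Im z) 1}"
  unfolding kernel_quot_def[abs_def]
proof (intro holomorphic_intros)
  show "w + \<i> \<noteq> 0" if "w \<in> {w. Im w > - min (Im z) 1}" for w
    using that by (auto simp: complex_eq_iff)
qed (use quotient_notin_slit assms in auto)

text \<open>In the variable p = 1/(w + i) the function is continuous on a compact disc that also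
  contains p = 0, the image of infinity.\<close>

lemma kernel_quot_bounded:
  assumes "Im z > 0"
  obtains B where "B > 0" "\<And>w. Im w \<ge> 0 \<Longrightarrow> norm (kernel_quot z \<alpha> w) \<le> B"
proof -
  have "continuous_on inv_disc (\<lambda>p. (1 + (z - \<i>) * p) powr (- of_real \<alpha>))"
    by (intro continuous_on_powr_slit_plane affine_inv_disc_notin_slit assms continuous_intros)
  from compact_imp_bounded[OF compact_continuous_image[OF this compact_cball]]
  obtain B where B: "B > 0" "\<And>p. p \<in> inv_disc \<Longrightarrow> norm ((1 + (z - \<i>) * p) powr (- of_real \<alpha>)) \<le> B"
    unfolding bounded_pos by blast
  show ?thesis
    using B(1) B(2)[OF inverse_plus_ii_in_inv_disc] by (intro that[of B]) (auto simp: kernel_quot_def)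
qed

lemma kernel_quot_of_real:
  assumes "Im z > 0"
  shows "kernel_quot z \<alpha> (of_real \<tau>) = (\<i> + of_real \<tau>) powr of_real \<alpha> / (z + of_real \<tau>) powr of_real \<alpha>"
proof -
  have "complex_of_real \<tau> + \<i> \<noteq> 0" by (auto simp: complex_eq_iff)
  then have "1 + (z - \<i>) / (of_real \<tau> + \<i>) = (z + of_real \<tau>) / (\<i> + of_real \<tau>)"
    by (simp add: field_simps)
  then show ?thesis
    using assms by (simp add: kernel_quot_def powr_minus powr_divide_upper_half_plane)
qed

subsection \<open>The kernel\<close>

lemma borel_measurable_cayley_mix [measurable (raw)]:
  assumes [measurable]: "f \<in> borel_measurable M" "g \<in> borel_measurable M" "h \<in> borel_measurable M"
  shows "(\<lambda>x. cayley_mix (f x) (g x) (h x)) \<in> borel_measurable M"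
  unfolding cayley_mix_def cayley_inv_def cayley_def by measurable

text \<open>The real part of the work in \<open>kernG\<close>: an average of Poisson kernels,
  nonnegative and of total mass pi for every s \<noteq> t. Splitting off the complex power leaves a
  kernel that can serve as a majorant.\<close>

definition poisson_mix :: "real \<Rightarrow> real \<Rightarrow> real \<Rightarrow> real \<Rightarrow> real \<Rightarrow> real" where
  "poisson_mix \<alpha>\<^sub>1 \<alpha>\<^sub>2 \<tau> s t = (LINT r:{0<..<1}|lborel.
      Im (1 / (of_real \<tau> - cayley_mix s t r)) * (beta_weight \<alpha>\<^sub>1 \<alpha>\<^sub>2 r / Beta \<alpha>\<^sub>1 \<alpha>\<^sub>2))"

lemma kernG_eq_poisson_mix:
  "kernG \<alpha>\<^sub>1 \<alpha>\<^sub>2 \<tau> s t = (\<i> + of_real \<tau>) powr of_real (\<alpha>\<^sub>1 + \<alpha>\<^sub>2) / of_real pi * of_real (poisson_mix \<alpha>\<^sub>1 \<alpha>\<^sub>2 \<tau> s t)"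
  by (simp add: kernG_def poisson_mix_def cayley_mix_def beta_weight_def)

lemma borel_measurable_poisson_mix [measurable (raw)]:
  assumes [measurable]: "f \<in> borel_measurable M" "g \<in> borel_measurable M" "h \<in> borel_measurable M"
  shows "(\<lambda>x. poisson_mix a b (f x) (g x) (h x)) \<in> borel_measurable M"
  unfolding poisson_mix_def set_lebesgue_integral_def
  by measurable

lemma Beta_pos_real: "a > 0 \<Longrightarrow> b > 0 \<Longrightarrow> Beta a b > (0::real)"
  by (simp add: Beta_def)

lemma Im_poisson_kernel_nonneg:
  assumes "Im \<zeta> \<ge> 0"
  shows "Im (1 / (complex_of_real \<tau> - \<zeta>)) \<ge> 0"
  using assms by (simp add: Im_divide)

section \<open>Fubini for the average of Poisson kernels\<close>

context
  fixes a b s t :: real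
  assumes ab: "a > 0" "b > 0" and st: "s \<noteq> t"
begin

private definition mix_density :: "real \<Rightarrow> real \<Rightarrow> real" where
  "mix_density r \<tau> = indicator {0<..<1} r * (Im (1 / (of_real \<tau> - cayley_mix s t r)) * (beta_weight a b r / Beta a b))"

private lemma poisson_mix_eq_integral: "poisson_mix a b \<tau> s t = (LINT r|lborel. mix_density r \<tau>)"
  by (simp add: poisson_mix_def set_lebesgue_integral_def mix_density_def)

private lemma mix_density_nonneg: "mix_density r \<tau> \<ge> 0"
  using Im_poisson_kernel_nonneg[OF less_imp_le[OF Im_cayley_mix[OF st, of r]]] Beta_pos_real[OF ab]
  by (auto simp: mix_density_def indicator_def)

lemma poisson_mix_nonneg: "poisson_mix a b \<tau> s t \<ge> 0"
  unfolding poisson_mix_eq_integral by (intro Bochner_Integration.integral_nonneg mix_density_nonneg)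

private lemma integrable_mix_density_snd: "integrable lborel (mix_density r)"
proof (cases "r \<in> {0<..<1}")
  case True
  then show ?thesis
    using integrable_poisson_kernel[OF Im_cayley_mix[OF st, of r]] unfolding mix_density_def by simp
qed (simp add: mix_density_def[abs_def])

private lemma integral_mix_density_snd: "(LINT \<tau>|lborel. mix_density r \<tau>) = indicator {0<..<1} r *\<^sub>R beta_weight a b r * (pi / Beta a b)"
proof (cases "r \<in> {0<..<1}")
  case True
  then show ?thesis
    using integral_poisson_kernel[OF Im_cayley_mix[OF st, of r]] unfolding mix_density_def by simp
qed (simp add: mix_density_def[abs_def])

private lemma integrable_mix_density: "integrable (lborel \<Otimes>\<^sub>M lborel) (\<lambda>(r, \<tau>). mix_density r \<tau>)"
proof (rule lborel_pair.Fubini_integrable)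
  show "(\<lambda>(r, \<tau>). mix_density r \<tau>) \<in> borel_measurable (lborel \<Otimes>\<^sub>M lborel)"
    unfolding mix_density_def by measurable
  show "integrable lborel (\<lambda>r. LINT \<tau>|lborel. norm (case (r, \<tau>) of (r, \<tau>) \<Rightarrow> mix_density r \<tau>))"
    using set_integrable_beta_weight[OF ab] unfolding set_integrable_def
    by (simp only: prod.case real_norm_def abs_of_nonneg[OF mix_density_nonneg] integral_mix_density_snd) simp
qed (simp add: integrable_mix_density_snd)

lemma integrable_poisson_mix: "integrable lborel (\<lambda>\<tau>. poisson_mix a b \<tau> s t)"
  using lborel_pair.integrable_snd[OF integrable_mix_density] by (simp add: poisson_mix_eq_integral)

lemma integral_poisson_mix: "(LINT \<tau>|lborel. poisson_mix a b \<tau> s t) = pi"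
proof -
  have "(LINT \<tau>|lborel. poisson_mix a b \<tau> s t) = (LINT r|lborel. (LINT \<tau>|lborel. mix_density r \<tau>))"
    unfolding poisson_mix_eq_integral by (rule lborel_pair.Fubini_integral[OF integrable_mix_density])
  also have "\<dots> = Beta a b * (pi / Beta a b)"
    unfolding integral_mix_density_snd using set_integral_beta_weight[OF ab]
    by (simp add: set_lebesgue_integral_def)
  finally show ?thesis using Beta_pos_real[OF ab] by simp
qed

text \<open>Boundedness of F keeps the product integrable in (r, \<tau>), so the \<tau>-integral may
  be done under the average over r. There \<open>rep\<close> evaluates it, \<Phi> r playing the role
  of the value of the extension of F at \<zeta>_r.\<close>

lemma integral_poisson_mix_times:
  fixes F \<Phi> :: "real \<Rightarrow> complex"
  assumes [measurable]: "F \<in> borel_measurable borel" and B: "\<And>\<tau>. norm (F \<tau>) \<le> B"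
    and rep: "\<And>r. r \<in> {0<..<1} \<Longrightarrow>
       (LINT \<tau>|lborel. complex_of_real (Im (1 / (of_real \<tau> - cayley_mix s t r))) * F \<tau>) = pi * \<Phi> r"
  shows "(LINT \<tau>|lborel. of_real (poisson_mix a b \<tau> s t) * F \<tau>)
           = pi / Beta a b * (LINT r:{0<..<1}|lborel. of_real (beta_weight a b r) * \<Phi> r)"
proof -
  have B0: "B \<ge> 0" using order_trans[OF norm_ge_zero B[of 0]] .
  have [measurable]: "(\<lambda>(r, \<tau>). mix_density r \<tau>) \<in> borel_measurable (lborel \<Otimes>\<^sub>M lborel)"
    using integrable_mix_density by auto
  have int: "integrable (lborel \<Otimes>\<^sub>M lborel) (\<lambda>(r, \<tau>). of_real (mix_density r \<tau>) * F \<tau>)"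
  proof (rule Bochner_Integration.integrable_bound)
    show "integrable (lborel \<Otimes>\<^sub>M lborel) (\<lambda>p. B * (case p of (r, \<tau>) \<Rightarrow> mix_density r \<tau>))"
      by (intro integrable_mult_right integrable_mix_density)
    show "(\<lambda>(r, \<tau>). of_real (mix_density r \<tau>) * F \<tau>) \<in> borel_measurable (lborel \<Otimes>\<^sub>M lborel)"
      by measurable
    show "AE p in lborel \<Otimes>\<^sub>M lborel. norm (case p of (r, \<tau>) \<Rightarrow> of_real (mix_density r \<tau>) * F \<tau>)
        \<le> norm (B * (case p of (r, \<tau>) \<Rightarrow> mix_density r \<tau>))"
      using B B0 mix_density_nonneg by (intro AE_I2) (auto simp: norm_mult abs_mult mult.commute[of B] intro!: mult_left_mono)
  qed
  have "(LINT \<tau>|lborel. of_real (poisson_mix a b \<tau> s t) * F \<tau>)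
      = (LINT \<tau>|lborel. (LINT r|lborel. of_real (mix_density r \<tau>) * F \<tau>))"
    by (simp add: poisson_mix_eq_integral integral_mult_left_zero)
  also have "\<dots> = (LINT r|lborel. (LINT \<tau>|lborel. of_real (mix_density r \<tau>) * F \<tau>))"
    by (rule lborel_pair.Fubini_integral[OF int])
  also have "\<dots> = (LINT r|lborel. (pi / Beta a b) * (indicator {0<..<1} r *\<^sub>R (of_real (beta_weight a b r) * \<Phi> r)))"
  proof (rule Bochner_Integration.integral_cong)
    show "(LINT \<tau>|lborel. of_real (mix_density r \<tau>) * F \<tau>) =
       (pi / Beta a b) * (indicator {0<..<1} r *\<^sub>R (of_real (beta_weight a b r) * \<Phi> r))" for r
    proof (cases "r \<in> {0<..<1}")
      case True
      then have "(LINT \<tau>|lborel. of_real (mix_density r \<tau>) * F \<tau>) = (LINT \<tau>|lborel. of_real (beta_weight a b r / Beta a b) *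
          (complex_of_real (Im (1 / (of_real \<tau> - cayley_mix s t r))) * F \<tau>))"
        by (intro Bochner_Integration.integral_cong) (auto simp: mix_density_def)
      also have "\<dots> = of_real (beta_weight a b r / Beta a b) * (pi * \<Phi> r)"
        by (simp only: integral_mult_right_zero rep[OF True])
      finally show ?thesis using True by simp
    qed (simp add: mix_density_def)
  qed simp
  also have "\<dots> = pi / Beta a b * (LINT r:{0<..<1}|lborel. of_real (beta_weight a b r) * \<Phi> r)"
    unfolding set_lebesgue_integral_def by (rule integral_mult_right_zero)
  finally show ?thesis .
qed

end

lemma continuous_on_powr_plus_real:
  assumes "Im z > 0"
  shows "continuous_on UNIV (\<lambda>t. (z + complex_of_real t) powr c)"
  using assms by (intro continuous_on_powr_slit_plane continuous_intros) (auto simp: complex_nonpos_Reals_iff)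

lemma borel_measurable_powr_plus_real [measurable]:
  assumes "Im z > 0"
  shows "(\<lambda>t. (z + complex_of_real t) powr c) \<in> borel_measurable borel"
  by (intro borel_measurable_continuous_onI continuous_on_powr_plus_real assms)

proposition integral_kernG:
  assumes ab: "\<alpha>\<^sub>1 > 0" "\<alpha>\<^sub>2 > 0" and st: "s \<noteq> t" and z: "Im z > 0"
  shows "(LINT \<tau>|lborel. kernG \<alpha>\<^sub>1 \<alpha>\<^sub>2 \<tau> s t / (z + of_real \<tau>) powr of_real (\<alpha>\<^sub>1 + \<alpha>\<^sub>2))
           = kernel_quot z \<alpha>\<^sub>1 (of_real s) * kernel_quot z \<alpha>\<^sub>2 (of_real t)"
proof -
  define \<alpha> where "\<alpha> = \<alpha>\<^sub>1 + \<alpha>\<^sub>2"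
  define A where "A = 1 + (z - \<i>) / (of_real s + \<i>)"
  define B where "B = 1 + (z - \<i>) / (of_real t + \<i>)"
  define W where "W = (\<lambda>r. of_real r * A + of_real (1 - r) * B)"
  obtain C where C: "\<And>w. Im w \<ge> 0 \<Longrightarrow> norm (kernel_quot z \<alpha> w) \<le> C"
    using kernel_quot_bounded[OF z] by blast
  have W: "W r = 1 + (z - \<i>) * (of_real r * (1 / (of_real s + \<i>)) + of_real (1 - r) * (1 / (of_real t + \<i>)))" for r
    by (simp add: W_def A_def B_def algebra_simps diff_divide_distrib)
  have seg: "W r \<notin> \<real>\<^sub>\<le>\<^sub>0" if "0 \<le> r" "r \<le> 1" for r
  proof -
    have "of_real r * (1 / (complex_of_real s + \<i>)) + of_real (1 - r) * (1 / (complex_of_real t + \<i>)) \<in> inv_disc"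
      using convexD[OF convex_cball inverse_plus_ii_in_inv_disc[of "of_real s"] inverse_plus_ii_in_inv_disc[of "of_real t"],
          of r "1 - r"] that by (simp add: scaleR_conv_of_real)
    then show ?thesis unfolding W by (rule affine_inv_disc_notin_slit[OF _ z])
  qed
  have [measurable]: "(\<lambda>\<tau>. kernel_quot z \<alpha> (complex_of_real \<tau>)) \<in> borel_measurable borel"
    unfolding kernel_quot_of_real[OF z] using z by measurable
  have "(LINT \<tau>|lborel. kernG \<alpha>\<^sub>1 \<alpha>\<^sub>2 \<tau> s t / (z + of_real \<tau>) powr of_real \<alpha>)
      = (LINT \<tau>|lborel. (1 / pi) * (of_real (poisson_mix \<alpha>\<^sub>1 \<alpha>\<^sub>2 \<tau> s t) * kernel_quot z \<alpha> (of_real \<tau>)))"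
    by (simp add: kernG_eq_poisson_mix kernel_quot_of_real[OF z] \<alpha>_def mult_ac)
  also have "\<dots> = (1 / pi) * (LINT \<tau>|lborel. of_real (poisson_mix \<alpha>\<^sub>1 \<alpha>\<^sub>2 \<tau> s t) * kernel_quot z \<alpha> (of_real \<tau>))"
    by (rule integral_mult_right_zero)
  also have "(LINT \<tau>|lborel. of_real (poisson_mix \<alpha>\<^sub>1 \<alpha>\<^sub>2 \<tau> s t) * kernel_quot z \<alpha> (of_real \<tau>))
      = pi / Beta \<alpha>\<^sub>1 \<alpha>\<^sub>2 * (LINT r:{0<..<1}|lborel. of_real (beta_weight \<alpha>\<^sub>1 \<alpha>\<^sub>2 r) * W r powr (- of_real \<alpha>))"
  proof (rule integral_poisson_mix_times[OF ab st])
    show "norm (kernel_quot z \<alpha> (of_real \<tau>)) \<le> C" for \<tau> :: real by (rule C) simp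
    fix r :: real assume r: "r \<in> {0<..<1}"
    have "(LINT \<tau>|lborel. complex_of_real (Im (1 / (of_real \<tau> - cayley_mix s t r))) * kernel_quot z \<alpha> (of_real \<tau>))
       = pi * kernel_quot z \<alpha> (cayley_mix s t r)"
      using z r st by (intro poisson_half_plane[OF kernel_quot_holomorphic[OF z] _ C] Im_cayley_mix) auto
    \<comment> \<open>The base is affine in 1/(w + i), so its value at \<zeta>_r is the same mixture
      of its values A at s and B at t.\<close>
    also have "kernel_quot z \<alpha> (cayley_mix s t r) = W r powr (- of_real \<alpha>)"
      using inverse_cayley_mix[OF st, of r] r unfolding kernel_quot_def W by (simp add: divide_inverse)
    finally show "(LINT \<tau>|lborel. complex_of_real (Im (1 / (of_real \<tau> - cayley_mix s t r))) * kernel_quot z \<alpha> (of_real \<tau>))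
       = pi * W r powr (- of_real \<alpha>)" .
  qed measurable
  also have "(LINT r:{0<..<1}|lborel. of_real (beta_weight \<alpha>\<^sub>1 \<alpha>\<^sub>2 r) * W r powr (- of_real \<alpha>))
      = Beta \<alpha>\<^sub>1 \<alpha>\<^sub>2 * (A powr (- of_real \<alpha>\<^sub>1) * B powr (- of_real \<alpha>\<^sub>2))"
    unfolding W_def \<alpha>_def by (rule feynman_parametrization[OF ab]) (use seg in \<open>simp add: W_def\<close>)
  finally show ?thesis
    using Beta_pos_real[OF ab] by (simp add: \<alpha>_def kernel_quot_def A_def B_def)
qed

subsection \<open>Products of generalized Cauchy transforms\<close>

text \<open>The weight is integrable and strictly positive, so its superlevel sets have finite
  measure by Markov's inequality and exhaust the line. Fubini relies on this.\<close>

lemma in_M_imp_sigma_finite: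
  assumes "in_M \<alpha> M h"
  shows "sigma_finite_measure M"
proof
  have M: "sets M = sets borel" and int: "integrable M (\<lambda>t. (1 + \<bar>t\<bar>) powr (- \<alpha>))"
    using assms by (auto simp: in_M_def)
  have sp: "space M = UNIV" using sets_eq_imp_space_eq[OF M] by simp
  define A where "A = (\<lambda>n::nat. {t \<in> space M. (1 + \<bar>t\<bar>) powr (- \<alpha>) \<ge> 1 / Suc n})"
  have "emeasure M (A n) \<noteq> \<infinity>" for n
  proof -
    have "emeasure M (A n) \<le> ennreal (1 / (1 / Suc n) * (LINT t|M. (1 + \<bar>t\<bar>) powr (- \<alpha>)))"
      unfolding A_def by (rule integral_Markov_inequality[OF int]) auto
    then show ?thesis by (auto simp: top_unique)
  qed
  moreover have "A n \<in> sets M" for n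
    unfolding A_def using borel_measurable_integrable[OF int] by measurable
  moreover have "(\<Union>n. A n) = space M"
  proof -
    have "\<exists>n. 1 / real (Suc n) \<le> (1 + \<bar>t\<bar>) powr (- \<alpha>)" for t :: real
    proof -
      have "1 + \<bar>t\<bar> > 0" by simp
      then have "(1 + \<bar>t\<bar>) powr (- \<alpha>) > 0" by simp
      from reals_Archimedean[OF this] show ?thesis
        by (metis inverse_eq_divide less_imp_le)
    qed
    then show ?thesis by (auto simp: A_def sp)
  qed
  ultimately show "\<exists>A. countable A \<and> A \<subseteq> sets M \<and> \<Union> A = space M \<and> (\<forall>a\<in>A. emeasure M a \<noteq> \<infinity>)"
    by (intro exI[of _ "range A"]) auto
qed

section \<open>Comparison of the weights 1 + |t| and |i + t|\<close>

lemma norm_ii_plus_real_powr: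
  "norm ((\<i> + complex_of_real t) powr of_real \<alpha>) = norm (\<i> + complex_of_real t) powr \<alpha>"
  by (simp add: norm_powr_real_powr')

lemma norm_ii_plus_real:
  "norm (\<i> + complex_of_real t) \<ge> 1" "norm (\<i> + complex_of_real t) \<le> 1 + \<bar>t\<bar>"
  "1 + \<bar>t\<bar> \<le> 2 * norm (\<i> + complex_of_real t)"
proof -
  show 1: "norm (\<i> + complex_of_real t) \<ge> 1"
    using abs_Im_le_cmod[of "\<i> + complex_of_real t"] by simp
  show "norm (\<i> + complex_of_real t) \<le> 1 + \<bar>t\<bar>"
    using norm_triangle_ineq[of \<i> "complex_of_real t"] by simp
  show "1 + \<bar>t\<bar> \<le> 2 * norm (\<i> + complex_of_real t)"
    using 1 abs_Re_le_cmod[of "\<i> + complex_of_real t"] by simp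
qed

lemma in_M_integrable:
  assumes "in_M \<alpha> M h" "\<alpha> > 0"
  shows in_M_integrable_weight: "integrable M (\<lambda>t. of_real ((1 + \<bar>t\<bar>) powr (- \<alpha>)) * h t)"
    and in_M_integrable_ii: "integrable M (\<lambda>t. h t / (\<i> + of_real t) powr of_real \<alpha>)"
proof -
  have M [measurable_cong]: "sets M = sets borel" and [measurable]: "h \<in> borel_measurable borel"
    and h: "\<And>t. norm (h t) = 1" and int: "integrable M (\<lambda>t. (1 + \<bar>t\<bar>) powr (- \<alpha>))"
    using assms by (auto simp: in_M_def)
  show "integrable M (\<lambda>t. of_real ((1 + \<bar>t\<bar>) powr (- \<alpha>)) * h t)"
    by (rule Bochner_Integration.integrable_bound[OF int]) (auto simp: norm_mult h)
  show "integrable M (\<lambda>t. h t / (\<i> + of_real t) powr of_real \<alpha>)"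
  \<comment> \<open>The constant comes from 1 + |t| \<le> 2 |i + t|, raised to the power
    \<alpha>.\<close>
  proof (rule Bochner_Integration.integrable_bound[OF integrable_mult_right[OF int, of "2 powr \<alpha>"]])
    show "(\<lambda>t. h t / (\<i> + of_real t) powr of_real \<alpha>) \<in> borel_measurable M"
      by measurable
    show "AE t in M. norm (h t / (\<i> + of_real t) powr of_real \<alpha>) \<le> norm (2 powr \<alpha> * (1 + \<bar>t\<bar>) powr (- \<alpha>))"
    proof (rule AE_I2)
      fix t
      have "(1 + \<bar>t\<bar>) powr \<alpha> \<le> (2 * norm (\<i> + complex_of_real t)) powr \<alpha>"
        using norm_ii_plus_real[of t] assms by (intro powr_mono2) auto
      also have "\<dots> = 2 powr \<alpha> * norm (\<i> + complex_of_real t) powr \<alpha>"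
        by (simp add: powr_mult)
      finally have "(1 + \<bar>t\<bar>) powr \<alpha> \<le> 2 powr \<alpha> * norm (\<i> + complex_of_real t) powr \<alpha>" .
      moreover have "norm (\<i> + complex_of_real t) powr \<alpha> > 0" "(1 + \<bar>t\<bar>) powr \<alpha> > 0"
        using norm_ii_plus_real(1)[of t] by auto
      ultimately have "1 / norm (\<i> + complex_of_real t) powr \<alpha> \<le> 2 powr \<alpha> / (1 + \<bar>t\<bar>) powr \<alpha>"
        by (simp add: field_simps)
      then show "norm (h t / (\<i> + of_real t) powr of_real \<alpha>) \<le> norm (2 powr \<alpha> * (1 + \<bar>t\<bar>) powr (- \<alpha>))"
        by (simp add: norm_divide norm_ii_plus_real_powr h powr_minus_divide)
    qed
  qed
qed

text \<open>The measure \<mu> enters through its two parts, a density against Lebesgue measure and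
  one against \<open>M2\<close>. Integrability of both weighted densities expresses its membership
  in the weighted space, and its Cauchy transform is the sum of the two integrals.\<close>

theorem theorem7p6:
  fixes \<alpha>\<^sub>1 \<alpha>\<^sub>2 :: real and M1 M2 :: "real measure" and h1 h2 :: "real \<Rightarrow> complex"
  assumes "\<alpha>\<^sub>1 > 0" and "\<alpha>\<^sub>2 > 0"
    and "in_M \<alpha>\<^sub>1 M1 h1" and "in_M \<alpha>\<^sub>2 M2 h2"
  shows "integrable lborel (\<lambda>\<tau>. complex_of_real ((1 + \<bar>\<tau>\<bar>) powr (- (\<alpha>\<^sub>1 + \<alpha>\<^sub>2)))
                                   * dens_u \<alpha>\<^sub>1 \<alpha>\<^sub>2 M1 h1 M2 h2 \<tau>)
    \<and> integrable M2 (\<lambda>\<tau>. complex_of_real ((1 + \<bar>\<tau>\<bar>) powr (- (\<alpha>\<^sub>1 + \<alpha>\<^sub>2)))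
                                   * atom M1 h1 \<tau> * h2 \<tau>)
    \<and> (\<forall>z. Im z > 0 \<longrightarrow>
           gen_cauchy \<alpha>\<^sub>1 M1 h1 z * gen_cauchy \<alpha>\<^sub>2 M2 h2 z =
             (LINT \<tau>|lborel. dens_u \<alpha>\<^sub>1 \<alpha>\<^sub>2 M1 h1 M2 h2 \<tau>
                 / (z + complex_of_real \<tau>) powr complex_of_real (\<alpha>\<^sub>1 + \<alpha>\<^sub>2))
             + (LINT \<tau>|M2. atom M1 h1 \<tau> * h2 \<tau>
                 / (z + complex_of_real \<tau>) powr complex_of_real (\<alpha>\<^sub>1 + \<alpha>\<^sub>2)))"
proof -
  note \<alpha> = assms(1,2)
  define \<alpha> where "\<alpha> = \<alpha>\<^sub>1 + \<alpha>\<^sub>2"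
  have sets [measurable_cong]: "sets M1 = sets borel" "sets M2 = sets borel"
    and h_meas [measurable]: "h1 \<in> borel_measurable borel" "h2 \<in> borel_measurable borel"
    using assms by (auto simp: in_M_def)
  interpret M1: sigma_finite_measure M1 by (rule in_M_imp_sigma_finite[OF assms(3)])
  interpret M2: sigma_finite_measure M2 by (rule in_M_imp_sigma_finite[OF assms(4)])
  have pair: "pair_sigma_finite M1 M2" ..
  then interpret P: pair_sigma_finite M1 M2 .
  interpret PL: pair_sigma_finite "M1 \<Otimes>\<^sub>M M2" lborel ..

  define c1 where "c1 = (\<lambda>s. h1 s / (\<i> + of_real s) powr of_real \<alpha>\<^sub>1)"
  define c2 where "c2 = (\<lambda>t. h2 t / (\<i> + of_real t) powr of_real \<alpha>\<^sub>2)"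
  have c_int: "integrable M1 c1" "integrable M2 c2"
    unfolding c1_def c2_def using in_M_integrable_ii assms by blast+
  have c_meas [measurable]: "c1 \<in> borel_measurable borel" "c2 \<in> borel_measurable borel"
    unfolding c1_def c2_def by measurable
  \<comment> \<open>Building the restriction to s \<noteq> t into the integrand lets Fubini run over
    the full product measure.\<close>
  define off where "off = (\<lambda>p. if fst p \<noteq> snd p then c1 (fst p) * c2 (snd p) else 0)"
  have off_int: "integrable (M1 \<Otimes>\<^sub>M M2) off"
    unfolding off_def
    by (rule Bochner_Integration.integrable_bound[OF P.integrable_fst_times_snd[OF c_int]]) auto
  have off_meas [measurable]: "off \<in> borel_measurable (M1 \<Otimes>\<^sub>M M2)"
    using off_int by auto
  \<comment> \<open>Pulling the factor w inside is valid even where the integral diverges and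
    defaults to 0, so this holds at every \<tau>.\<close>
  have dens: "dens_u \<alpha>\<^sub>1 \<alpha>\<^sub>2 M1 h1 M2 h2 \<tau> * w =
      (LINT p|(M1 \<Otimes>\<^sub>M M2). off p * (kernG \<alpha>\<^sub>1 \<alpha>\<^sub>2 \<tau> (fst p) (snd p) * w))" for \<tau> w
    unfolding dens_u_def integral_mult_left_zero[symmetric]
    by (intro Bochner_Integration.integral_cong) (auto simp: off_def c1_def c2_def)

  \<comment> \<open>Used for two choices of W, the weight (1 + |\<tau>|)^(-\<alpha>) and the Cauchy
    kernel 1/(z + \<tau>)^\<alpha>. Both decay fast enough to cancel the growth of (i +
    \<tau>)^\<alpha> in \<open>kernG\<close>.\<close>
  have main: "integrable ((M1 \<Otimes>\<^sub>M M2) \<Otimes>\<^sub>M lborel)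
         (\<lambda>(p, \<tau>). off p * (kernG \<alpha>\<^sub>1 \<alpha>\<^sub>2 \<tau> (fst p) (snd p) * W \<tau>))"
    if [measurable]: "W \<in> borel_measurable borel"
      and C: "\<And>\<tau>. norm ((\<i> + of_real \<tau>) powr of_real \<alpha> * W \<tau>) \<le> C" for W C
  proof (rule Bochner_Integration.integrable_bound)
    define D where "D = (\<lambda>p \<tau>. norm (off p) * poisson_mix \<alpha>\<^sub>1 \<alpha>\<^sub>2 \<tau> (fst p) (snd p))"
    have D_nonneg: "D p \<tau> \<ge> 0" for p \<tau>
      using poisson_mix_nonneg[OF \<alpha>] by (auto simp: D_def off_def)
    \<comment> \<open>Off the diagonal the kernel has mass pi; on it \<open>off\<close> vanishes, so
      both sides are 0.\<close>
    have D_snd: "integrable lborel (D p)" "(LINT \<tau>|lborel. D p \<tau>) = norm (off p) * pi" for p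
      using integrable_poisson_mix[OF \<alpha>, of "fst p" "snd p"] integral_poisson_mix[OF \<alpha>, of "fst p" "snd p"]
      by (cases "fst p = snd p"; simp add: D_def[abs_def] off_def)+
    have "integrable ((M1 \<Otimes>\<^sub>M M2) \<Otimes>\<^sub>M lborel) (\<lambda>(p, \<tau>). D p \<tau>)"
    proof (rule PL.Fubini_integrable)
      show "(\<lambda>(p, \<tau>). D p \<tau>) \<in> borel_measurable ((M1 \<Otimes>\<^sub>M M2) \<Otimes>\<^sub>M lborel)"
        unfolding D_def by measurable
      show "integrable (M1 \<Otimes>\<^sub>M M2) (\<lambda>p. LINT \<tau>|lborel. norm (case (p, \<tau>) of (p, \<tau>) \<Rightarrow> D p \<tau>))"
        by (simp only: prod.case real_norm_def abs_of_nonneg[OF D_nonneg] D_snd)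
           (intro integrable_mult_left integrable_norm off_int)
    qed (simp add: D_snd)
    then show "integrable ((M1 \<Otimes>\<^sub>M M2) \<Otimes>\<^sub>M lborel) (\<lambda>q. (C / pi) * (case q of (p, \<tau>) \<Rightarrow> D p \<tau>))"
      by (rule integrable_mult_right)
    show "(\<lambda>(p, \<tau>). off p * (kernG \<alpha>\<^sub>1 \<alpha>\<^sub>2 \<tau> (fst p) (snd p) * W \<tau>))
        \<in> borel_measurable ((M1 \<Otimes>\<^sub>M M2) \<Otimes>\<^sub>M lborel)"
      unfolding kernG_eq_poisson_mix by measurable
    have "norm (off p * (kernG \<alpha>\<^sub>1 \<alpha>\<^sub>2 \<tau> (fst p) (snd p) * W \<tau>)) \<le> norm (C / pi * D p \<tau>)" for p \<tau>
    proof -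
      have "norm (off p * (kernG \<alpha>\<^sub>1 \<alpha>\<^sub>2 \<tau> (fst p) (snd p) * W \<tau>))
          = norm ((\<i> + of_real \<tau>) powr of_real \<alpha> * W \<tau>) / pi * \<bar>D p \<tau>\<bar>"
        by (simp add: kernG_eq_poisson_mix \<alpha>_def D_def norm_mult norm_divide abs_mult)
      also have "\<dots> \<le> C / pi * D p \<tau>"
        unfolding abs_of_nonneg[OF D_nonneg]
        by (intro mult_right_mono divide_right_mono C D_nonneg) simp
      also have "\<dots> \<le> norm (C / pi * D p \<tau>)" unfolding real_norm_def by (rule abs_ge_self)
      finally show ?thesis .
    qed
    then show "AE q in (M1 \<Otimes>\<^sub>M M2) \<Otimes>\<^sub>M lborel.
        norm (case q of (p, \<tau>) \<Rightarrow> off p * (kernG \<alpha>\<^sub>1 \<alpha>\<^sub>2 \<tau> (fst p) (snd p) * W \<tau>))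
          \<le> norm ((C / pi) * (case q of (p, \<tau>) \<Rightarrow> D p \<tau>))"
      by (intro AE_I2) (simp only: split_paired_all prod.case)
  qed

  show ?thesis
  proof (intro conjI allI impI)
    have "norm ((\<i> + of_real \<tau>) powr of_real \<alpha> * complex_of_real ((1 + \<bar>\<tau>\<bar>) powr (- \<alpha>))) \<le> 1" for \<tau>
    proof -
      have "norm (\<i> + complex_of_real \<tau>) powr \<alpha> \<le> (1 + \<bar>\<tau>\<bar>) powr \<alpha>"
        using norm_ii_plus_real[of \<tau>] \<alpha> by (intro powr_mono2) (auto simp: \<alpha>_def)
      then show ?thesis
        by (simp add: norm_mult norm_divide norm_ii_plus_real_powr powr_minus_divide divide_le_eq_1)
    qed
    from main[OF _ this]
    have "integrable lborel (\<lambda>\<tau>. LINT p|(M1 \<Otimes>\<^sub>M M2). off p * (kernG \<alpha>\<^sub>1 \<alpha>\<^sub>2 \<tau> (fst p) (snd p) *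
            complex_of_real ((1 + \<bar>\<tau>\<bar>) powr (- \<alpha>))))"
      by (intro PL.integrable_snd) auto
    then show "integrable lborel (\<lambda>\<tau>. complex_of_real ((1 + \<bar>\<tau>\<bar>) powr (- (\<alpha>\<^sub>1 + \<alpha>\<^sub>2)))
                                   * dens_u \<alpha>\<^sub>1 \<alpha>\<^sub>2 M1 h1 M2 h2 \<tau>)"
      unfolding dens[symmetric] \<alpha>_def by (simp add: mult.commute)

    \<comment> \<open>Since the weight splits into one factor per measure, the atomic part is the
      diagonal of a product of two integrable functions.\<close>
    have "complex_of_real ((1 + \<bar>\<tau>\<bar>) powr (- (\<alpha>\<^sub>1 + \<alpha>\<^sub>2)))
        = of_real ((1 + \<bar>\<tau>\<bar>) powr (- \<alpha>\<^sub>1)) * of_real ((1 + \<bar>\<tau>\<bar>) powr (- \<alpha>\<^sub>2))" for \<tau>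
      unfolding of_real_mult[symmetric] powr_add[symmetric] by simp
    then show "integrable M2 (\<lambda>\<tau>. complex_of_real ((1 + \<bar>\<tau>\<bar>) powr (- (\<alpha>\<^sub>1 + \<alpha>\<^sub>2)))
                                   * atom M1 h1 \<tau> * h2 \<tau>)"
      using integrable_atom_times[OF pair sets in_M_integrable_weight[OF assms(3,1)] in_M_integrable_weight[OF assms(4,2)]]
      by (simp add: atom_def mult_ac)
  next
    fix z :: complex assume z: "Im z > 0"
    have [measurable]: "(\<lambda>t. kernel_quot z a (complex_of_real t)) \<in> borel_measurable borel" for a
      unfolding kernel_quot_of_real[OF z] using z by measurable
    have ii_nz: "(\<i> + complex_of_real t) powr of_real a \<noteq> 0" for t a
      using norm_ii_plus_real(1)[of t] by auto
    \<comment> \<open>These are the integrands of the two given transforms, written as an integrable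
      density times a bounded quotient.\<close>
    define k1 where "k1 = (\<lambda>s. c1 s * kernel_quot z \<alpha>\<^sub>1 (of_real s))"
    define k2 where "k2 = (\<lambda>t. c2 t * kernel_quot z \<alpha>\<^sub>2 (of_real t))"
    have k_eq: "k1 s = h1 s / (z + of_real s) powr of_real \<alpha>\<^sub>1" "k2 s = h2 s / (z + of_real s) powr of_real \<alpha>\<^sub>2" for s
      using ii_nz by (simp_all add: k1_def k2_def c1_def c2_def kernel_quot_of_real[OF z])
    have k_int: "integrable M1 k1" "integrable M2 k2"
    proof -
      have bounded: "integrable M (\<lambda>t. c t * kernel_quot z a (of_real t))"
        if "integrable M c" "sets M = sets borel" for M c a
      proof -
        note [measurable_cong] = that(2)
        have [measurable]: "c \<in> borel_measurable M" using that(1) by auto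
        obtain B where B: "B > 0" "\<And>w. Im w \<ge> 0 \<Longrightarrow> norm (kernel_quot z a w) \<le> B"
          using kernel_quot_bounded[OF z] by blast
        show ?thesis
        proof (rule Bochner_Integration.integrable_bound)
          show "integrable M (\<lambda>t. B * norm (c t))"
            by (intro integrable_mult_right integrable_norm that)
          show "AE t in M. norm (c t * kernel_quot z a (of_real t)) \<le> norm (B * norm (c t))"
            using B by (auto simp: norm_mult abs_mult mult.commute[of B] intro!: mult_left_mono)
        qed measurable
      qed
      show "integrable M1 k1" "integrable M2 k2"
        unfolding k1_def k2_def using bounded c_int sets by blast+
    qed
    define W where "W = (\<lambda>\<tau>. 1 / (z + complex_of_real \<tau>) powr of_real \<alpha>)"
    have [measurable]: "W \<in> borel_measurable borel"
      unfolding W_def using z by measurable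
    obtain C where C: "\<And>w. Im w \<ge> 0 \<Longrightarrow> norm (kernel_quot z \<alpha> w) \<le> C"
      using kernel_quot_bounded[OF z] by blast
    have "norm ((\<i> + of_real \<tau>) powr of_real \<alpha> * W \<tau>) \<le> C" for \<tau> :: real
      using C[of "of_real \<tau>"] by (simp add: kernel_quot_of_real[OF z] W_def)
    note W_int = main[OF \<open>W \<in> borel_measurable borel\<close> this]

    have "(LINT \<tau>|lborel. dens_u \<alpha>\<^sub>1 \<alpha>\<^sub>2 M1 h1 M2 h2 \<tau> / (z + of_real \<tau>) powr of_real (\<alpha>\<^sub>1 + \<alpha>\<^sub>2))
        = (LINT \<tau>|lborel. dens_u \<alpha>\<^sub>1 \<alpha>\<^sub>2 M1 h1 M2 h2 \<tau> * W \<tau>)"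
      by (simp add: W_def \<alpha>_def)
    also have "\<dots> = (LINT p|(M1 \<Otimes>\<^sub>M M2). (LINT \<tau>|lborel. off p * (kernG \<alpha>\<^sub>1 \<alpha>\<^sub>2 \<tau> (fst p) (snd p) * W \<tau>)))"
      unfolding dens by (rule PL.Fubini_integral[OF W_int])
    also have "\<dots> = (LINT p|(M1 \<Otimes>\<^sub>M M2). (if fst p \<noteq> snd p then k1 (fst p) * k2 (snd p) else 0))"
    proof (rule Bochner_Integration.integral_cong)
      show "(LINT \<tau>|lborel. off p * (kernG \<alpha>\<^sub>1 \<alpha>\<^sub>2 \<tau> (fst p) (snd p) * W \<tau>))
          = (if fst p \<noteq> snd p then k1 (fst p) * k2 (snd p) else 0)" for p
      proof (cases "fst p = snd p")
        case False
        have "(LINT \<tau>|lborel. kernG \<alpha>\<^sub>1 \<alpha>\<^sub>2 \<tau> (fst p) (snd p) * W \<tau>)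
            = kernel_quot z \<alpha>\<^sub>1 (of_real (fst p)) * kernel_quot z \<alpha>\<^sub>2 (of_real (snd p))"
          using integral_kernG[OF \<alpha> False z] by (simp add: W_def \<alpha>_def)
        then show ?thesis
          unfolding integral_mult_right_zero using False by (simp add: off_def k1_def k2_def)
      qed (simp add: off_def)
    qed simp
    finally have dens_integral: "(LINT \<tau>|lborel. dens_u \<alpha>\<^sub>1 \<alpha>\<^sub>2 M1 h1 M2 h2 \<tau> / (z + of_real \<tau>) powr of_real (\<alpha>\<^sub>1 + \<alpha>\<^sub>2))
        = (LINT p|(M1 \<Otimes>\<^sub>M M2). (if fst p \<noteq> snd p then k1 (fst p) * k2 (snd p) else 0))" .

    have [measurable]: "k1 \<in> borel_measurable borel" "k2 \<in> borel_measurable borel"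
      unfolding k1_def k2_def by measurable
    have off_k: "integrable (M1 \<Otimes>\<^sub>M M2) (\<lambda>p. if fst p \<noteq> snd p then k1 (fst p) * k2 (snd p) else 0)"
      by (rule Bochner_Integration.integrable_bound[OF P.integrable_fst_times_snd[OF k_int]]) auto
    have "gen_cauchy \<alpha>\<^sub>1 M1 h1 z * gen_cauchy \<alpha>\<^sub>2 M2 h2 z = (LINT p|(M1 \<Otimes>\<^sub>M M2). k1 (fst p) * k2 (snd p))"
      unfolding P.integral_fst_times_snd[OF k_int] by (simp add: gen_cauchy_def k_eq[symmetric])
    also have "\<dots> = (LINT p|(M1 \<Otimes>\<^sub>M M2). (if fst p \<noteq> snd p then k1 (fst p) * k2 (snd p) else 0)
                     + (if fst p = snd p then k1 (fst p) * k2 (snd p) else 0))"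
      by (intro Bochner_Integration.integral_cong) auto
    also have "\<dots> = (LINT p|(M1 \<Otimes>\<^sub>M M2). (if fst p \<noteq> snd p then k1 (fst p) * k2 (snd p) else 0))
        + (LINT p|(M1 \<Otimes>\<^sub>M M2). (if fst p = snd p then k1 (fst p) * k2 (snd p) else 0))"
      by (rule Bochner_Integration.integral_add[OF off_k integrable_diagonal_times[OF pair sets k_int]])
    \<comment> \<open>On the diagonal both denominators have the same base z + \<tau>, so the
      exponents simply add.\<close>
    also have "(LINT p|(M1 \<Otimes>\<^sub>M M2). (if fst p = snd p then k1 (fst p) * k2 (snd p) else 0))
        = (LINT \<tau>|M2. atom M1 h1 \<tau> * h2 \<tau> / (z + of_real \<tau>) powr of_real (\<alpha>\<^sub>1 + \<alpha>\<^sub>2))"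
      unfolding integral_diagonal_times[OF pair sets k_int]
      by (intro Bochner_Integration.integral_cong) (simp_all add: atom_def k_eq powr_add mult_ac)
    finally show "gen_cauchy \<alpha>\<^sub>1 M1 h1 z * gen_cauchy \<alpha>\<^sub>2 M2 h2 z =
             (LINT \<tau>|lborel. dens_u \<alpha>\<^sub>1 \<alpha>\<^sub>2 M1 h1 M2 h2 \<tau>
                 / (z + complex_of_real \<tau>) powr complex_of_real (\<alpha>\<^sub>1 + \<alpha>\<^sub>2))
             + (LINT \<tau>|M2. atom M1 h1 \<tau> * h2 \<tau>
                 / (z + complex_of_real \<tau>) powr complex_of_real (\<alpha>\<^sub>1 + \<alpha>\<^sub>2))"
      unfolding dens_integral .
  qed
qed

end
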